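(* There exists a numerical constant $C>0$ such that for all integers $p\ge n\ge1$, all invertible covariance matrices $\boldsymbol\Sigma\in\mathbb{R}^{p\times p}$ with inverse $\boldsymbol\Omega=\boldsymbol\Sigma^{-1}$, all $\beta^*\in\mathbb{R}^p$ and all $\sigma>0$, the estimator $$\widehat\eta^D(\boldsymbol\Omega):=\frac{Y^T\left(\mathbf{X}\boldsymbol\Omega\mathbf{X}^T-\mathrm{tr}(\mathbf{X}\boldsymbol\Omega\mathbf{X}^T)\mathbf{I}_n/n\right)Y}{(n+1)\|Y\|_2^2}$$ satisfies $$\mathbb{E}\left[\big(\widehat\eta^D(\boldsymbol\Omega)-\eta\big)^2\right]\le C\frac{p}{n^2}.$$
   Context: Model: $Y=(y_1,\dots,y_n)^T=\mathbf{X}\beta^*+\epsilon$, where $\mathbf{X}\in\mathbb{R}^{n\times p}$ has i.i.d. rows with distribution $\mathcal{N}(0,\boldsymbol\Sigma)$, $\epsilon\sim\mathcal{N}(0,\sigma^2\mathbf{I}_n)$ is independent of $\mathbf{X}$, $\boldsymbol\Sigma$ is invertible, $\sigma>0$ and $\beta^*\in\mathbb{R}^p$. The proportion of explained variation is $$\eta:=\frac{\beta^{*T}\boldsymbol\Sigma\beta^*}{\sigma^2+\beta^{*T}\boldsymbol\Sigma\beta^*}.$$ *)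

theory Defs
  imports "HOL-Probability.Probability" "Jordan_Normal_Form.Matrix"
begin

text \<open>
  The dimensions n and p are bound inside the statement, so vectors and matrices are those of
  Jordan_Normal_Form, with explicit carriers.  These types carry no sigma-algebra: probability
  laws live on the product spaces of extensional coordinate functions (index sets {..<p} and
  {..<n}), and outcomes are turned into vectors and matrices entrywise.
\<close>

hide_const (open) Finite_Cartesian_Product.vec Finite_Cartesian_Product.mat
no_notation inner (infix "\<bullet>" 70)

definition mat_trace :: "real mat \<Rightarrow> real" where
  "mat_trace A = (\<Sum>i<dim_row A. A $$ (i, i))"

definition covariance_mat :: "nat \<Rightarrow> real mat \<Rightarrow> bool" where
  "covariance_mat p \<Sigma> \<longleftrightarrow> \<Sigma> \<in> carrier_mat p p \<and> transpose_mat \<Sigma> = \<Sigma> \<and>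
     (\<forall>v\<in>carrier_vec p. 0 \<le> v \<bullet> (\<Sigma> *\<^sub>v v))"

abbreviation coord_space :: "nat \<Rightarrow> (nat \<Rightarrow> real) measure" where
  "coord_space d \<equiv> PiM {..<d} (\<lambda>_. borel)"

definition std_normal_vec :: "nat \<Rightarrow> (nat \<Rightarrow> real) measure" where
  "std_normal_vec d = PiM {..<d} (\<lambda>_. std_normal_distribution)"

text \<open>
  N is the law N(0, S) iff it is the law of A z with z standard normal and A A^T = S.
  The law does not depend on the choice of A, and an A exists iff S is a covariance matrix.
\<close>

definition centred_normal :: "nat \<Rightarrow> real mat \<Rightarrow> (nat \<Rightarrow> real) measure \<Rightarrow> bool" where
  "centred_normal d S N \<longleftrightarrow> (\<exists>A\<in>carrier_mat d d. A * transpose_mat A = S \<and>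
     N = distr (std_normal_vec d) (coord_space d)
           (\<lambda>z. \<lambda>i\<in>{..<d}. (A *\<^sub>v vec d z) $ i))"

text \<open>
  Joint law of the rows of the design and of the noise: n independent rows with common law N,
  independent of the noise, which has law E.  By the lemma below, this is the law of design and
  noise on every probability space that carries the model.
\<close>

definition design_noise_law ::
  "nat \<Rightarrow> (nat \<Rightarrow> real) measure \<Rightarrow> (nat \<Rightarrow> real) measure \<Rightarrow>
   ((nat \<Rightarrow> nat \<Rightarrow> real) \<times> (nat \<Rightarrow> real)) measure" where
  "design_noise_law n N E = PiM {..<n} (\<lambda>_. N) \<Otimes>\<^sub>M E"

lemma (in prob_space) distr_design_noise:
  fixes x :: "nat \<Rightarrow> 'a \<Rightarrow> nat \<Rightarrow> real" and e :: "'a \<Rightarrow> nat \<Rightarrow> real"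
  assumes n: "1 \<le> n"
    and rows_indep: "indep_vars (\<lambda>_. coord_space p) x {..<n}"
    and row_law: "\<And>i. i < n \<Longrightarrow> distr M (coord_space p) (x i) = N"
    and noise: "random_variable (coord_space n) e"
    and noise_law: "distr M (coord_space n) e = E"
    and noise_indep:
      "indep_set {(\<lambda>\<omega>. \<lambda>i\<in>{..<n}. x i \<omega>) -` A \<inter> space M | A. A \<in> sets (PiM {..<n} (\<lambda>_. coord_space p))}
                 {e -` B \<inter> space M | B. B \<in> sets (coord_space n)}"
  shows "distr M (PiM {..<n} (\<lambda>_. coord_space p) \<Otimes>\<^sub>M coord_space n)
           (\<lambda>\<omega>. (\<lambda>i\<in>{..<n}. x i \<omega>, e \<omega>)) = design_noise_law n N E"
proof -
  let ?S = "PiM {..<n} (\<lambda>_. coord_space p)" and ?X = "\<lambda>\<omega>. \<lambda>i\<in>{..<n}. x i \<omega>"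
  let ?XE = "\<lambda>\<omega>. (?X \<omega>, e \<omega>)"
  have rv: "random_variable (coord_space p) (x i)" if "i \<in> {..<n}" for i
    using rows_indep that unfolding indep_vars_def by blast
  have X: "random_variable ?S ?X"
    by (rule measurable_restrict) (rule rv)
  have XE: "random_variable (?S \<Otimes>\<^sub>M coord_space n) ?XE"
    using X noise by (rule measurable_Pair)
  have "distr M ?S ?X = PiM {..<n} (\<lambda>i. distr M (coord_space p) (x i))"
    using n rows_indep rv
    by (subst indep_vars_iff_distr_eq_PiM'[symmetric]) (auto simp: lessThan_empty_iff)
  also have "\<dots> = PiM {..<n} (\<lambda>_. N)"
    by (intro PiM_cong) (auto simp: row_law)
  finally have X_law: "distr M ?S ?X = PiM {..<n} (\<lambda>_. N)" .
  interpret PX: prob_space "distr M ?S ?X"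
    by (rule prob_space_distr) (rule X)
  interpret PE: prob_space "distr M (coord_space n) e"
    by (rule prob_space_distr) (rule noise)
  have "distr M ?S ?X \<Otimes>\<^sub>M distr M (coord_space n) e = distr M (?S \<Otimes>\<^sub>M coord_space n) ?XE"
  proof (rule pair_measure_eqI)
    show "sigma_finite_measure (distr M ?S ?X)" "sigma_finite_measure (distr M (coord_space n) e)"
      by unfold_locales
    show "sets (distr M ?S ?X \<Otimes>\<^sub>M distr M (coord_space n) e)
            = sets (distr M (?S \<Otimes>\<^sub>M coord_space n) ?XE)"
      by (simp cong: sets_pair_measure_cong)
  next
    fix A B assume "A \<in> sets (distr M ?S ?X)" "B \<in> sets (distr M (coord_space n) e)"
    then have A: "A \<in> sets ?S" and B: "B \<in> sets (coord_space n)" by simp_all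
    have eq: "?XE -` (A \<times> B) \<inter> space M = (?X -` A \<inter> space M) \<inter> (e -` B \<inter> space M)"
      by auto
    have "prob ((?X -` A \<inter> space M) \<inter> (e -` B \<inter> space M))
            = prob (?X -` A \<inter> space M) * prob (e -` B \<inter> space M)"
      by (rule indep_setD[OF noise_indep]) (use A B in blast)+
    then show "emeasure (distr M ?S ?X) A * emeasure (distr M (coord_space n) e) B
            = emeasure (distr M (?S \<Otimes>\<^sub>M coord_space n) ?XE) (A \<times> B)"
      using A B
      by (simp add: emeasure_distr[OF X] emeasure_distr[OF noise] emeasure_distr[OF XE] eq
          emeasure_eq_measure ennreal_mult' del: vimage_Int)
  qed
  then show ?thesis
    unfolding design_noise_law_def X_law noise_law by simp
qed

definition design_mat :: "nat \<Rightarrow> nat \<Rightarrow> (nat \<Rightarrow> nat \<Rightarrow> real) \<Rightarrow> real mat" where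
  "design_mat n p x = mat n p (\<lambda>(i, j). x i j)"

definition response :: "real mat \<Rightarrow> real vec \<Rightarrow> real vec \<Rightarrow> real vec" where
  "response X \<beta> \<epsilon> = X *\<^sub>v \<beta> + \<epsilon>"

definition explained_variation :: "real mat \<Rightarrow> real vec \<Rightarrow> real \<Rightarrow> real" where
  "explained_variation \<Sigma> \<beta> \<sigma> = (\<beta> \<bullet> (\<Sigma> *\<^sub>v \<beta>)) / (\<sigma>\<^sup>2 + \<beta> \<bullet> (\<Sigma> *\<^sub>v \<beta>))"

text \<open>On the null event Y = 0 the quotient is 0, by the convention x / 0 = 0.\<close>

definition eta_hat :: "nat \<Rightarrow> real mat \<Rightarrow> real mat \<Rightarrow> real vec \<Rightarrow> real" where
  "eta_hat n \<Omega> X Y =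
     (let G = X * \<Omega> * transpose_mat X
      in (Y \<bullet> ((G - (mat_trace G / real n) \<cdot>\<^sub>m 1\<^sub>m n) *\<^sub>v Y)) / ((real n + 1) * (Y \<bullet> Y)))"

definition squared_error ::
  "nat \<Rightarrow> nat \<Rightarrow> real mat \<Rightarrow> real mat \<Rightarrow> real vec \<Rightarrow> real \<Rightarrow>
   (nat \<Rightarrow> nat \<Rightarrow> real) \<times> (nat \<Rightarrow> real) \<Rightarrow> real" where
  "squared_error n p \<Sigma> \<Omega> \<beta> \<sigma> = (\<lambda>(x, e).
     let X = design_mat n p x; Y = response X \<beta> (vec n e)
     in (eta_hat n \<Omega> X Y - explained_variation \<Sigma> \<beta> \<sigma>)\<^sup>2)"

end

(*
Whitening the design and rotating its rows by an orthogonal map reduces the model to independent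
standard normal columns Z_0, ..., Z_{p-1} and w in R^n with Y = s Z_0 - sigma w, where s^2 is the
signal variance, and X Omega X^T = Z Z^T.  A reflection of the pair (Z_0, w) makes the direction
v of Y independent of everything else: Y = tau v and Z_0 = c v + d u with c^2 = eta.  Given v, a
Householder reflection taking v to |v| e_0 leaves the law of the columns unchanged and turns
(n + 1) (estimator - eta) into a constant plus a sum of independent centred functions of single
normal variables.  Its second moment is explicit and is at most
  2 (|v|^2 - n)^2 + |v|^2 + 8 + 2 p,
whose expectation over v is 5 n + 8 + 2 p.
*)
theory Submission
  imports Defs "Jordan_Normal_Form.Determinant"
begin

section \<open>Orthogonal invariance of the standard normal law\<close>

text \<open>The obstacle is the random denominator \<open>|Y|^2\<close>: moments of the numerator
  alone do not control a quotient. The quotient is unchanged when Y is rescaled, so Y may be divided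
  by the standard deviation tau of its entries. Once v is fixed, the denominator is a constant and
  the numerator a quadratic polynomial in Gaussian variables, whose second moment is exact. After
  the division \<open>|v|\<close> survives only with nonnegative powers, in the constant term and in
  one linear term, so no inverse moment of \<open>|v|\<close> is needed. The number c is the
  correlation between corresponding entries of Z_0 and v, whence c^2 = eta.

  Invariance of the Gaussian law is brought down to one planar reflection and one-dimensional
  substitutions: planar reflections conjugate a Householder reflection to a sign flip, and
  Householder reflections compose to any orthogonal map. Reflections rather than rotations are the
  building blocks because they are their own inverses. Estimates are made for nonnegative integrals,
  where Fubini asks only for measurability; integrability of the squared error follows from the
  final bound.\<close>

abbreviation gauss :: "'i set \<Rightarrow> ('i \<Rightarrow> real) measure" where
  "gauss I \<equiv> PiM I (\<lambda>_. std_normal_distribution)"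

interpretation std_normal: prob_space std_normal_distribution
  using prob_space_normal_density[of 1 0] by simp

interpretation gauss: product_sigma_finite "\<lambda>_::'i. std_normal_distribution"
  by unfold_locales

text \<open>The matrix with rows (a, c) and (c, -a) is orthogonal, and the joint density depends
  only on the distance to the origin. The change of variables is done one coordinate at a time: for
  fixed x the second argument \<open>v = c * x - a * y\<close> replaces y, and after exchanging the
  integrals \<open>x = c * v + a * u\<close> makes u the first argument. Both steps divide by a, and
  the factors \<open>1 / \<bar>a\<bar>\<close> and \<open>\<bar>a\<bar>\<close> cancel.\<close>

lemma nn_integral_std_normal_reflect:
  fixes a c :: real
  assumes ac: "a\<^sup>2 + c\<^sup>2 = 1" and a: "a \<noteq> 0"
    and f [measurable]: "case_prod f \<in> borel_measurable (borel \<Otimes>\<^sub>M borel)"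
  shows "(\<integral>\<^sup>+x. \<integral>\<^sup>+y. f (a * x + c * y) (c * x - a * y) \<partial>std_normal_distribution \<partial>std_normal_distribution)
       = (\<integral>\<^sup>+x. \<integral>\<^sup>+y. f x y \<partial>std_normal_distribution \<partial>std_normal_distribution)"
proof -
  let ?\<phi> = std_normal_density
  have split: "(\<integral>\<^sup>+x. \<integral>\<^sup>+y. g x y \<partial>std_normal_distribution \<partial>std_normal_distribution)
      = (\<integral>\<^sup>+x. \<integral>\<^sup>+y. ennreal (?\<phi> x * ?\<phi> y) * g x y \<partial>lborel \<partial>lborel)"
    if [measurable]: "case_prod g \<in> borel_measurable (borel \<Otimes>\<^sub>M borel)" for g :: "real \<Rightarrow> real \<Rightarrow> ennreal"
    by (simp add: nn_integral_density nn_integral_cmult[symmetric] ennreal_mult mult.assoc)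
  have dens: "?\<phi> (c * v + a * u) * ?\<phi> (c * u - a * v) = ?\<phi> u * ?\<phi> v" for u v
  proof -
    have "(c * v + a * u)\<^sup>2 + (c * u - a * v)\<^sup>2 = (a\<^sup>2 + c\<^sup>2) * (u\<^sup>2 + v\<^sup>2)"
      by (simp add: power2_eq_square algebra_simps)
    then have e: "(c * v + a * u)\<^sup>2 = u\<^sup>2 + v\<^sup>2 - (c * u - a * v)\<^sup>2" using ac by simp
    show ?thesis
      unfolding std_normal_density_def e by (simp add: exp_add[symmetric] field_simps)
  qed
  have "(\<integral>\<^sup>+x. \<integral>\<^sup>+y. f (a * x + c * y) (c * x - a * y) \<partial>std_normal_distribution \<partial>std_normal_distribution)
      = (\<integral>\<^sup>+x. \<integral>\<^sup>+y. ennreal (?\<phi> x * ?\<phi> y) * f (a * x + c * y) (c * x - a * y) \<partial>lborel \<partial>lborel)"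
    by (rule split) measurable
  also have "\<dots> = (\<integral>\<^sup>+x. ennreal \<bar>- 1 / a\<bar> * (\<integral>\<^sup>+v. ennreal (?\<phi> x * ?\<phi> (c * x / a + (- 1 / a) * v))
        * f (a * x + c * (c * x / a + (- 1 / a) * v)) (c * x - a * (c * x / a + (- 1 / a) * v)) \<partial>lborel) \<partial>lborel)"
    using a by (intro nn_integral_cong nn_integral_real_affine) auto
  also have "\<dots> = ennreal \<bar>- 1 / a\<bar> * (\<integral>\<^sup>+x. \<integral>\<^sup>+v. ennreal (?\<phi> x * ?\<phi> (c * x / a + (- 1 / a) * v))
        * f (a * x + c * (c * x / a + (- 1 / a) * v)) (c * x - a * (c * x / a + (- 1 / a) * v)) \<partial>lborel \<partial>lborel)"
    by (intro nn_integral_cmult) measurable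
  also have "\<dots> = ennreal \<bar>- 1 / a\<bar> * (\<integral>\<^sup>+v. \<integral>\<^sup>+x. ennreal (?\<phi> x * ?\<phi> (c * x / a + (- 1 / a) * v))
        * f (a * x + c * (c * x / a + (- 1 / a) * v)) (c * x - a * (c * x / a + (- 1 / a) * v)) \<partial>lborel \<partial>lborel)"
    by (subst lborel_pair.Fubini') measurable
  also have "\<dots> = ennreal \<bar>- 1 / a\<bar> * (\<integral>\<^sup>+v. ennreal \<bar>a\<bar> * (\<integral>\<^sup>+u. ennreal (?\<phi> u * ?\<phi> v) * f u v \<partial>lborel) \<partial>lborel)"
  proof (intro arg_cong2[where f="(*)"] refl nn_integral_cong)
    fix v :: real
    have y: "c * (c * v + a * u) / a + (- 1 / a) * v = c * u - a * v" for u
    proof -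
      have "c * (c * v + a * u) / a + (- 1 / a) * v = (c\<^sup>2 * v + a * c * u - v) / a"
        by (simp add: add_divide_distrib diff_divide_distrib algebra_simps power2_eq_square)
      also have "c\<^sup>2 = 1 - a\<^sup>2" using ac by simp
      also have "((1 - a\<^sup>2) * v + a * c * u - v) / a = c * u - a * v"
        using a by (simp add: add_divide_distrib diff_divide_distrib algebra_simps power2_eq_square)
      finally show ?thesis .
    qed
    have x: "a * (c * v + a * u) + c * (c * u - a * v) = u" for u
    proof -
      have "a * (c * v + a * u) + c * (c * u - a * v) = (a\<^sup>2 + c\<^sup>2) * u"
        by (simp add: power2_eq_square algebra_simps)
      with ac show ?thesis by simp
    qed
    have z: "c * (c * v + a * u) - a * (c * u - a * v) = v" for u
    proof -
      have "c * (c * v + a * u) - a * (c * u - a * v) = (a\<^sup>2 + c\<^sup>2) * v"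
        by (simp add: power2_eq_square algebra_simps)
      with ac show ?thesis by simp
    qed
    show "(\<integral>\<^sup>+x. ennreal (?\<phi> x * ?\<phi> (c * x / a + (- 1 / a) * v))
        * f (a * x + c * (c * x / a + (- 1 / a) * v)) (c * x - a * (c * x / a + (- 1 / a) * v)) \<partial>lborel)
      = ennreal \<bar>a\<bar> * (\<integral>\<^sup>+u. ennreal (?\<phi> u * ?\<phi> v) * f u v \<partial>lborel)"
      by (subst nn_integral_real_affine[where c=a and t="c * v"]) (measurable, simp_all only: y x z dens a not_False_eq_True)
  qed
  also have "\<dots> = ennreal \<bar>- 1 / a\<bar> * (ennreal \<bar>a\<bar> * (\<integral>\<^sup>+v. \<integral>\<^sup>+u. ennreal (?\<phi> u * ?\<phi> v) * f u v \<partial>lborel \<partial>lborel))"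
    by (subst nn_integral_cmult) measurable
  also have "\<dots> = (\<integral>\<^sup>+v. \<integral>\<^sup>+u. ennreal (?\<phi> u * ?\<phi> v) * f u v \<partial>lborel \<partial>lborel)"
    using a by (simp add: mult.assoc[symmetric] ennreal_mult[symmetric] abs_mult[symmetric])
  also have "\<dots> = (\<integral>\<^sup>+u. \<integral>\<^sup>+v. ennreal (?\<phi> u * ?\<phi> v) * f u v \<partial>lborel \<partial>lborel)"
    by (subst lborel_pair.Fubini') measurable
  finally show ?thesis by (simp add: split)
qed

lemma nn_integral_std_normal_minus:
  assumes [measurable]: "f \<in> borel_measurable borel"
  shows "(\<integral>\<^sup>+x. f (- x) \<partial>std_normal_distribution) = (\<integral>\<^sup>+x. f x \<partial>std_normal_distribution)"
proof -
  have "(\<integral>\<^sup>+x. f x \<partial>std_normal_distribution) = (\<integral>\<^sup>+x. ennreal (std_normal_density x) * f x \<partial>lborel)"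
    by (simp add: nn_integral_density)
  also have "\<dots> = (\<integral>\<^sup>+x. ennreal (std_normal_density x) * f (- x) \<partial>lborel)"
    by (subst nn_integral_real_affine[where c="- 1" and t=0]) (simp_all add: std_normal_density_def)
  finally show ?thesis by (simp add: nn_integral_density)
qed

section \<open>Measure-preserving maps: planar reflections, sign flips, Householder
  reflections\<close>

definition preserves :: "'a measure \<Rightarrow> ('a \<Rightarrow> 'a) \<Rightarrow> bool" where
  "preserves M T \<longleftrightarrow> T \<in> M \<rightarrow>\<^sub>M M \<and> distr M M T = M"

lemma preservesI:
  assumes T: "T \<in> M \<rightarrow>\<^sub>M M"
    and "\<And>f::_ \<Rightarrow> ennreal. f \<in> borel_measurable M \<Longrightarrow> (\<integral>\<^sup>+x. f (T x) \<partial>M) = (\<integral>\<^sup>+x. f x \<partial>M)"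
  shows "preserves M T"
  unfolding preserves_def
proof
  show "distr M M T = M"
  proof (rule measure_eqI)
    fix A assume "A \<in> sets (distr M M T)"
    then have A: "A \<in> sets M" by simp
    have "emeasure (distr M M T) A = (\<integral>\<^sup>+x. indicator A x \<partial>distr M M T)" using A by simp
    also have "\<dots> = (\<integral>\<^sup>+x. indicator A (T x) \<partial>M)" using A T by (subst nn_integral_distr) auto
    also have "\<dots> = emeasure M A" using A by (subst assms(2)) auto
    finally show "emeasure (distr M M T) A = emeasure M A" .
  qed simp
qed (rule T)

lemma preserves_nn_integral:
  assumes "preserves M T" "f \<in> borel_measurable M"
  shows "(\<integral>\<^sup>+x. f (T x) \<partial>M) = (\<integral>\<^sup>+x. f x \<partial>M)"
  using assms nn_integral_distr[of T M M f] unfolding preserves_def by simp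

lemma preserves_comp:
  assumes "preserves M S" "preserves M T"
  shows "preserves M (\<lambda>x. S (T x))"
proof (rule preservesI)
  have [measurable]: "S \<in> M \<rightarrow>\<^sub>M M" "T \<in> M \<rightarrow>\<^sub>M M" using assms by (auto simp: preserves_def)
  show "(\<lambda>x. S (T x)) \<in> M \<rightarrow>\<^sub>M M" by measurable
  fix f :: "_ \<Rightarrow> ennreal" assume [measurable]: "f \<in> borel_measurable M"
  show "(\<integral>\<^sup>+x. f (S (T x)) \<partial>M) = (\<integral>\<^sup>+x. f x \<partial>M)"
    using preserves_nn_integral[OF assms(2), of "\<lambda>x. f (S x)"] preserves_nn_integral[OF assms(1), of f] by simp
qed

lemma preserves_cong:
  assumes "\<And>x. x \<in> space M \<Longrightarrow> S x = T x"
  shows "preserves M S \<longleftrightarrow> preserves M T"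
  unfolding preserves_def using measurable_cong[of M S T M] distr_cong[of M M M M S T] assms by auto

text \<open>For \<open>a^2 + c^2 = 1\<close> this is the determinant -1 variant of a Givens
  rotation: a reflection of the plane of coordinates i and k, symmetric and hence its own
  inverse.\<close>

definition givens :: "'i \<Rightarrow> 'i \<Rightarrow> real \<Rightarrow> real \<Rightarrow> ('i \<Rightarrow> real) \<Rightarrow> 'i \<Rightarrow> real" where
  "givens i k a c g = g(i := a * g i + c * g k, k := c * g i - a * g k)"

lemma preserves_givens:
  assumes I: "finite I" and ik: "i \<in> I" "k \<in> I" "i \<noteq> k" and ac: "a\<^sup>2 + c\<^sup>2 = 1" "a \<noteq> 0"
  shows "preserves (gauss I) (givens i k a c)"
proof (rule preservesI)
  define J where "J = I - {i, k}"
  have J: "finite J" "k \<notin> J" "i \<notin> insert k J" and IJ: "I = insert i (insert k J)"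
    using I ik by (auto simp: J_def)
  have [simp]: "insert k I = I" "insert i I = I" using ik by auto
  show T [measurable]: "givens i k a c \<in> gauss I \<rightarrow>\<^sub>M gauss I"
  proof -
    have [measurable]: "(\<lambda>g. g i) \<in> borel_measurable (gauss I)" "(\<lambda>g. g k) \<in> borel_measurable (gauss I)"
      using ik measurable_component_singleton[of _ I "\<lambda>_. std_normal_distribution"] by auto
    have "(\<lambda>g. g(i := a * g i + c * g k)) \<in> gauss I \<rightarrow>\<^sub>M gauss I"
      by (rule measurable_fun_upd[where J=I]) auto
    then show ?thesis
      unfolding givens_def by (intro measurable_fun_upd[where J=I]) auto
  qed
  fix f :: "_ \<Rightarrow> ennreal" assume f [measurable]: "f \<in> borel_measurable (gauss I)"
  have upd [measurable]: "(\<lambda>(x, y). f (g(k := y, i := x))) \<in> borel_measurable (borel \<Otimes>\<^sub>M borel)"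
    if g: "g \<in> space (gauss J)" for g
  proof -
    have "(\<lambda>z. g(k := snd z, i := fst z)) \<in> borel \<Otimes>\<^sub>M borel \<rightarrow>\<^sub>M gauss I"
      using g unfolding IJ
      by (intro measurable_fun_upd[where J="insert k J"] measurable_fun_upd[where J="J"]) auto
    from measurable_compose[OF this f] show ?thesis by (simp add: split_beta')
  qed
  have fold: "(\<integral>\<^sup>+g. h g \<partial>gauss I) = (\<integral>\<^sup>+g. \<integral>\<^sup>+y. \<integral>\<^sup>+x. h (g(k := y, i := x)) 
      \<partial>std_normal_distribution \<partial>std_normal_distribution \<partial>gauss J)"
    if [measurable]: "h \<in> borel_measurable (gauss I)" for h :: "_ \<Rightarrow> ennreal"
  proof -
    have [measurable]: "h \<in> borel_measurable (gauss (insert i (insert k J)))" using that IJ by simp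
    show ?thesis
      unfolding IJ
      by (subst gauss.product_nn_integral_insert) (use J in simp_all,
          subst gauss.product_nn_integral_insert, use J in simp_all)
  qed
  have "(\<integral>\<^sup>+g. f (givens i k a c g) \<partial>gauss I) = (\<integral>\<^sup>+g. \<integral>\<^sup>+y. \<integral>\<^sup>+x. f (givens i k a c (g(k := y, i := x))) 
      \<partial>std_normal_distribution \<partial>std_normal_distribution \<partial>gauss J)"
    by (rule fold) measurable
  also have "\<dots> = (\<integral>\<^sup>+g. \<integral>\<^sup>+y. \<integral>\<^sup>+x. f (g(k := c * x - a * y, i := a * x + c * y)) 
      \<partial>std_normal_distribution \<partial>std_normal_distribution \<partial>gauss J)"
    using ik by (intro nn_integral_cong arg_cong[where f=f]) (auto simp: givens_def)
  also have "\<dots> = (\<integral>\<^sup>+g. \<integral>\<^sup>+y. \<integral>\<^sup>+x. f (g(k := y, i := x)) 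
      \<partial>std_normal_distribution \<partial>std_normal_distribution \<partial>gauss J)"
  proof (rule nn_integral_cong)
    fix g assume g: "g \<in> space (gauss J)"
    define F where "F x y = f (g(k := y, i := x))" for x y
    have F [measurable]: "case_prod F \<in> borel_measurable (borel \<Otimes>\<^sub>M borel)"
      unfolding F_def by (rule upd[OF g])
    interpret N: pair_sigma_finite std_normal_distribution std_normal_distribution by unfold_locales
    \<comment> \<open>Splitting off i and then k leaves the variable of k outermost, the opposite of
      the order in the planar lemma.\<close>
    have swap: "(\<integral>\<^sup>+y. \<integral>\<^sup>+x. H x y \<partial>std_normal_distribution \<partial>std_normal_distribution)
       = (\<integral>\<^sup>+x. \<integral>\<^sup>+y. H x y \<partial>std_normal_distribution \<partial>std_normal_distribution)"
      if [measurable]: "case_prod H \<in> borel_measurable (borel \<Otimes>\<^sub>M borel)" for H :: "real \<Rightarrow> real \<Rightarrow> ennreal"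
      by (rule N.Fubini') (use that in \<open>simp cong: measurable_cong_sets sets_pair_measure_cong\<close>)
    have "(\<integral>\<^sup>+y. \<integral>\<^sup>+x. F (a * x + c * y) (c * x - a * y) \<partial>std_normal_distribution \<partial>std_normal_distribution)
      = (\<integral>\<^sup>+y. \<integral>\<^sup>+x. F x y \<partial>std_normal_distribution \<partial>std_normal_distribution)"
      by (subst (1 2) swap) (use nn_integral_std_normal_reflect[OF ac F] in simp_all)
    then show "(\<integral>\<^sup>+y. \<integral>\<^sup>+x. f (g(k := c * x - a * y, i := a * x + c * y)) 
      \<partial>std_normal_distribution \<partial>std_normal_distribution) = (\<integral>\<^sup>+y. \<integral>\<^sup>+x. f (g(k := y, i := x)) 
      \<partial>std_normal_distribution \<partial>std_normal_distribution)"
      by (simp add: F_def)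
  qed
  also have "\<dots> = (\<integral>\<^sup>+g. f g \<partial>gauss I)" by (rule fold[symmetric]) measurable
  finally show "(\<integral>\<^sup>+g. f (givens i k a c g) \<partial>gauss I) = (\<integral>\<^sup>+g. f g \<partial>gauss I)" .
qed

lemma preserves_sign_flip:
  assumes I: "finite I" and i: "i \<in> I"
  shows "preserves (gauss I) (\<lambda>g. g(i := - g i))"
proof (rule preservesI)
  define J where "J = I - {i}"
  have J: "finite J" "i \<notin> J" and IJ: "I = insert i J" using I i by (auto simp: J_def)
  have [simp]: "insert i I = I" using i by auto
  show T [measurable]: "(\<lambda>g. g(i := - g i)) \<in> gauss I \<rightarrow>\<^sub>M gauss I"
    using i measurable_component_singleton[of i I "\<lambda>_. std_normal_distribution"]
    by (intro measurable_fun_upd[where J=I]) auto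
  fix f :: "_ \<Rightarrow> ennreal" assume f [measurable]: "f \<in> borel_measurable (gauss I)"
  have fold: "(\<integral>\<^sup>+g. h g \<partial>gauss I) = (\<integral>\<^sup>+g. \<integral>\<^sup>+x. h (g(i := x)) \<partial>std_normal_distribution \<partial>gauss J)"
    if [measurable]: "h \<in> borel_measurable (gauss I)" for h :: "_ \<Rightarrow> ennreal"
  proof -
    have [measurable]: "h \<in> borel_measurable (gauss (insert i J))" using that IJ by simp
    show ?thesis
      unfolding IJ by (subst gauss.product_nn_integral_insert) (use J in simp_all)
  qed
  have "(\<integral>\<^sup>+g. f (g(i := - g i)) \<partial>gauss I)
      = (\<integral>\<^sup>+g. \<integral>\<^sup>+x. f ((g(i := x))(i := - (g(i := x)) i)) \<partial>std_normal_distribution \<partial>gauss J)"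
    by (rule fold) measurable
  also have "\<dots> = (\<integral>\<^sup>+g. \<integral>\<^sup>+x. f (g(i := x)) \<partial>std_normal_distribution \<partial>gauss J)"
  proof (rule nn_integral_cong)
    fix g assume g: "g \<in> space (gauss J)"
    have "(\<lambda>x. g(i := x)) \<in> borel \<rightarrow>\<^sub>M gauss I"
      using g unfolding IJ by (intro measurable_fun_upd[where J=J]) auto
    from nn_integral_std_normal_minus[OF measurable_compose[OF this f]]
    show "(\<integral>\<^sup>+x. f ((g(i := x))(i := - (g(i := x)) i)) \<partial>std_normal_distribution)
        = (\<integral>\<^sup>+x. f (g(i := x)) \<partial>std_normal_distribution)" by simp
  qed
  also have "\<dots> = (\<integral>\<^sup>+g. f g \<partial>gauss I)" by (rule fold[symmetric]) measurable
  finally show "(\<integral>\<^sup>+g. f (g(i := - g i)) \<partial>gauss I) = (\<integral>\<^sup>+g. f g \<partial>gauss I)" .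
qed

text \<open>Householder reflection in the hyperplane orthogonal to u. If u vanishes on I, division
  by zero makes it the identity on I, so degenerate normal vectors need no separate treatment where
  it is applied. The restriction to I keeps values in the space of the product measure.\<close>

definition reflect :: "'i set \<Rightarrow> ('i \<Rightarrow> real) \<Rightarrow> ('i \<Rightarrow> real) \<Rightarrow> 'i \<Rightarrow> real" where
  "reflect I u g = (\<lambda>i\<in>I. g i - 2 * (\<Sum>k\<in>I. u k * g k) / (\<Sum>k\<in>I. (u k)\<^sup>2) * u i)"

lemma reflect_apply: "i \<in> I \<Longrightarrow> reflect I u g i = g i - 2 * (\<Sum>k\<in>I. u k * g k) / (\<Sum>k\<in>I. (u k)\<^sup>2) * u i"
  by (simp add: reflect_def)

lemma sum_givens:
  assumes I: "finite I" and ik: "i \<in> I" "k \<in> I" "i \<noteq> k" and ac: "a\<^sup>2 + c\<^sup>2 = 1"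
  shows "(\<Sum>j\<in>I. givens i k a c g j * givens i k a c h j) = (\<Sum>j\<in>I. g j * h j)"
proof -
  have IJ: "I = insert i (insert k (I - {i, k}))" using ik by auto
  have "(\<Sum>j\<in>I. givens i k a c g j * givens i k a c h j)
      = (a * g i + c * g k) * (a * h i + c * h k) + (c * g i - a * g k) * (c * h i - a * h k)
        + (\<Sum>j\<in>I - {i, k}. g j * h j)"
    using I ik by (subst IJ) (simp add: givens_def add.assoc)
  also have "(a * g i + c * g k) * (a * h i + c * h k) + (c * g i - a * g k) * (c * h i - a * h k)
      = (a\<^sup>2 + c\<^sup>2) * (g i * h i + g k * h k)"
    by (simp add: power2_eq_square algebra_simps)
  also have "(a\<^sup>2 + c\<^sup>2) * (g i * h i + g k * h k) + (\<Sum>j\<in>I - {i, k}. g j * h j) = (\<Sum>j\<in>I. g j * h j)"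
    using I ik ac by (subst (2) IJ) (simp add: add.assoc)
  finally show ?thesis .
qed

lemma givens_involution:
  assumes "i \<noteq> k" "a\<^sup>2 + c\<^sup>2 = 1"
  shows "a * givens i k a c g i + c * givens i k a c g k = g i"
    and "c * givens i k a c g i - a * givens i k a c g k = g k"
proof -
  have "a * givens i k a c g i + c * givens i k a c g k = (a\<^sup>2 + c\<^sup>2) * g i"
    using assms(1) by (simp add: givens_def power2_eq_square algebra_simps)
  then show "a * givens i k a c g i + c * givens i k a c g k = g i" using assms(2) by simp
  have "c * givens i k a c g i - a * givens i k a c g k = (a\<^sup>2 + c\<^sup>2) * g k"
    using assms(1) by (simp add: givens_def power2_eq_square algebra_simps)
  then show "c * givens i k a c g i - a * givens i k a c g k = g k" using assms(2) by simp
qed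

text \<open>Conjugating a reflection by an orthogonal involution gives the reflection along the
  image of the normal vector. This lets the normal vector be simplified by planar
  reflections.\<close>

lemma reflect_givens:
  assumes I: "finite I" and ik: "i \<in> I" "k \<in> I" "i \<noteq> k" and ac: "a\<^sup>2 + c\<^sup>2 = 1"
  shows "reflect I u g = restrict (givens i k a c (reflect I (givens i k a c u) (givens i k a c g))) I"
proof
  fix j
  let ?T = "givens i k a c"
  have 1: "(\<Sum>j\<in>I. ?T u j * ?T g j) = (\<Sum>j\<in>I. u j * g j)"
    and 2: "(\<Sum>j\<in>I. (?T u j)\<^sup>2) = (\<Sum>j\<in>I. (u j)\<^sup>2)"
    using sum_givens[OF assms] by (simp_all add: power2_eq_square)
  define s where "s = 2 * (\<Sum>j\<in>I. u j * g j) / (\<Sum>j\<in>I. (u j)\<^sup>2)"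
  have r: "reflect I (?T u) (?T g) j = ?T g j - s * ?T u j" if "j \<in> I" for j
    using that by (simp add: reflect_apply 1 2 s_def)
  have "?T (reflect I (?T u) (?T g)) j = g j - s * u j" if j: "j \<in> I"
  proof (cases "j = i \<or> j = k")
    case True
    have "?T (reflect I (?T u) (?T g)) i
        = (a * ?T g i + c * ?T g k) - s * (a * ?T u i + c * ?T u k)"
      using ik by (simp add: givens_def[of _ _ _ _ "reflect _ _ _"] r algebra_simps)
    moreover have "?T (reflect I (?T u) (?T g)) k
        = (c * ?T g i - a * ?T g k) - s * (c * ?T u i - a * ?T u k)"
      using ik by (simp add: givens_def[of _ _ _ _ "reflect _ _ _"] r algebra_simps)
    ultimately show ?thesis using True by (auto simp: givens_involution[OF ik(3) ac])
  next
    case False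
    then have "?T (reflect I (?T u) (?T g)) j = ?T g j - s * ?T u j"
      using j by (simp add: givens_def[of _ _ _ _ "reflect _ _ _"] r)
    also have "\<dots> = g j - s * u j" using False by (simp add: givens_def)
    finally show ?thesis .
  qed
  then show "reflect I u g j = restrict (?T (reflect I (?T u) (?T g))) I j"
    by (simp add: reflect_def s_def)
qed

lemma preserves_id: "preserves M (\<lambda>x. x)"
  by (simp add: preserves_def distr_id)

text \<open>Induction on the number of nonzero entries of u. If two entries are nonzero, the planar
  reflection with (a, c) proportional to \<open>(u i, u k)\<close> sends the k-th entry to
  \<open>c * u i - a * u k = 0\<close>, and conjugating by it leaves a reflection with a sparser
  normal vector. One nonzero entry gives a sign flip, none the identity.\<close>

lemma preserves_reflect:
  assumes I: "finite I"
  shows "preserves (gauss I) (reflect I u)"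
proof (induction "card {i\<in>I. u i \<noteq> 0}" arbitrary: u rule: less_induct)
  case less
  define S where "S = {i\<in>I. u i \<noteq> 0}"
  have fS: "finite S" "S \<subseteq> I" using I by (auto simp: S_def)
  have space: "g \<in> extensional I" if "g \<in> space (gauss I)" for g
    using that by (auto simp: space_PiM PiE_def)
  consider "S = {}" | i where "S = {i}" | i k where "i \<in> S" "k \<in> S" "i \<noteq> k"
    by (metis insertE is_singletonI' is_singleton_def)
  then show ?case
  proof cases
    case 1
    then have "u j = 0" if "j \<in> I" for j using that by (auto simp: S_def)
    then have "reflect I u g = g" if "g \<in> space (gauss I)" for g
      using space[OF that] by (auto simp: reflect_def fun_eq_iff extensional_def)
    then show ?thesis using preserves_id by (subst preserves_cong[where T="\<lambda>x. x"]) auto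
  next
    case (2 i)
    then have i: "i \<in> I" "u i \<noteq> 0" by (auto simp: S_def)
    have u0: "u j = 0" if "j \<in> I - {i}" for j using 2 that by (auto simp: S_def)
    have ug: "(\<Sum>j\<in>I. u j * g j) = u i * g i" for g
      using I i u0 by (simp add: sum.remove[of I i])
    have uu: "(\<Sum>j\<in>I. (u j)\<^sup>2) = (u i)\<^sup>2"
      using I i u0 by (simp add: sum.remove[of I i])
    then have "reflect I u g = g(i := - g i)" if "g \<in> space (gauss I)" for g
      using space[OF that] i u0
      by (auto simp: reflect_def ug uu fun_eq_iff extensional_def power2_eq_square)
    then show ?thesis using preserves_sign_flip[OF I i(1)] by (subst preserves_cong) auto
  next
    case (3 i k)
    then have i: "i \<in> I" "u i \<noteq> 0" and k: "k \<in> I" "u k \<noteq> 0" by (auto simp: S_def)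
    define r where "r = sqrt ((u i)\<^sup>2 + (u k)\<^sup>2)"
    have r2: "r\<^sup>2 = (u i)\<^sup>2 + (u k)\<^sup>2" by (simp add: r_def)
    have r: "r \<noteq> 0" using i by (simp add: r_def)
    define a c where "a = u i / r" and "c = u k / r"
    have ac: "a\<^sup>2 + c\<^sup>2 = 1" using r i by (simp add: a_def c_def power_divide add_divide_distrib[symmetric] r2[symmetric])
    have a: "a \<noteq> 0" using i r by (simp add: a_def)
    let ?T = "givens i k a c"
    have "?T u k = 0" using 3 by (simp add: givens_def a_def c_def)
    moreover have "?T u j = u j" if "j \<noteq> i" "j \<noteq> k" for j using that by (simp add: givens_def)
    ultimately have "{j\<in>I. ?T u j \<noteq> 0} \<subseteq> S - {k}"
      using i by (auto simp: S_def) metis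
    then have "card {j\<in>I. ?T u j \<noteq> 0} < card S"
      using 3 fS by (meson card_Diff1_less card_mono finite_Diff le_less_trans)
    from less[OF this[unfolded S_def]] have IH: "preserves (gauss I) (reflect I (?T u))" .
    have T: "preserves (gauss I) ?T" by (rule preserves_givens[OF I i(1) k(1) 3(3) ac a])
    have "preserves (gauss I) (\<lambda>g. ?T (reflect I (?T u) (?T g)))"
      by (rule preserves_comp[OF T preserves_comp[OF IH T]])
    moreover have "reflect I u g = ?T (reflect I (?T u) (?T g))" if "g \<in> space (gauss I)" for g
    proof -
      have "?T (reflect I (?T u) (?T g)) \<in> extensional I"
        using i k by (auto simp: givens_def reflect_def extensional_def)
      then show ?thesis
        by (subst reflect_givens[OF I i(1) k(1) 3(3) ac]) (rule extensional_restrict)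
    qed
    ultimately show ?thesis by (subst preserves_cong) auto
  qed
qed

lemma sum_reflect:
  assumes "finite I"
  shows "(\<Sum>i\<in>I. reflect I u g i * reflect I u h i) = (\<Sum>i\<in>I. g i * h i)"
proof (cases "(\<Sum>k\<in>I. (u k)\<^sup>2) = 0")
  case True
  then show ?thesis by (simp add: reflect_def)
next
  case False
  define N where "N = (\<Sum>k\<in>I. (u k)\<^sup>2)"
  define s t where "s = (\<Sum>k\<in>I. u k * g k)" and "t = (\<Sum>k\<in>I. u k * h k)"
  have r: "reflect I u g i = g i - 2 * s / N * u i" "reflect I u h i = h i - 2 * t / N * u i" if "i \<in> I" for i
    using that by (simp_all add: reflect_apply N_def s_def t_def)
  have "(\<Sum>i\<in>I. reflect I u g i * reflect I u h i)
      = (\<Sum>i\<in>I. g i * h i - 2 * t / N * (u i * g i) - 2 * s / N * (u i * h i) + 4 * s * t / N\<^sup>2 * (u i)\<^sup>2)"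
    by (intro sum.cong refl) (simp add: r algebra_simps power2_eq_square)
  also have "\<dots> = (\<Sum>i\<in>I. g i * h i) - (\<Sum>i\<in>I. 2 * t / N * (u i * g i))
      - (\<Sum>i\<in>I. 2 * s / N * (u i * h i)) + (\<Sum>i\<in>I. 4 * s * t / N\<^sup>2 * (u i)\<^sup>2)"
    by (simp only: sum.distrib sum_subtractf)
  also have "\<dots> = (\<Sum>i\<in>I. g i * h i) - 2 * t / N * s - 2 * s / N * t + 4 * s * t / N\<^sup>2 * N"
    by (simp only: sum_distrib_left[symmetric] N_def s_def t_def)
  also have "\<dots> = (\<Sum>i\<in>I. g i * h i)"
    using False by (simp add: N_def[symmetric] power2_eq_square)
  finally show ?thesis .
qed

lemma reflect_reflect:
  assumes "finite I" "i \<in> I"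
  shows "reflect I u (reflect I u g) i = g i"
proof (cases "(\<Sum>k\<in>I. (u k)\<^sup>2) = 0")
  case True
  then show ?thesis using assms by (simp add: reflect_def)
next
  case False
  define N where "N = (\<Sum>k\<in>I. (u k)\<^sup>2)"
  define s where "s = (\<Sum>k\<in>I. u k * g k)"
  have N: "N \<noteq> 0" using False by (simp add: N_def)
  have r: "reflect I u g i = g i - 2 * s / N * u i" if "i \<in> I" for i
    using that by (simp add: reflect_apply N_def s_def)
  have "(\<Sum>k\<in>I. u k * reflect I u g k) = (\<Sum>k\<in>I. u k * g k - 2 * s / N * (u k)\<^sup>2)"
    by (intro sum.cong refl) (simp add: r algebra_simps power2_eq_square)
  also have "\<dots> = s - 2 * s / N * N"
    by (simp only: sum_subtractf sum_distrib_left[symmetric] N_def s_def)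
  also have "\<dots> = - s" using N by simp
  finally show ?thesis
    using assms(2) by (simp add: reflect_apply N_def[symmetric] s_def[symmetric])
qed

lemma reflect_sum:
  assumes "finite I" "i \<in> I"
  shows "reflect I u (\<lambda>j. \<Sum>l\<in>L. c l * q l j) i = (\<Sum>l\<in>L. c l * reflect I u (q l) i)"
proof -
  have "(\<Sum>k\<in>I. u k * (\<Sum>l\<in>L. c l * q l k)) = (\<Sum>l\<in>L. c l * (\<Sum>k\<in>I. u k * q l k))"
    by (simp add: sum_distrib_left, subst sum.swap) (simp add: algebra_simps)
  then show ?thesis
    using assms(2)
    by (simp add: reflect_apply sum_distrib_left sum_distrib_right sum_divide_distrib right_diff_distrib
        sum_subtractf) (simp add: algebra_simps)
qed

lemma reflect_cong: "(\<And>i. i \<in> I \<Longrightarrow> g i = h i) \<Longrightarrow> reflect I u g = reflect I u h"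
  by (auto simp: reflect_def fun_eq_iff intro!: arg_cong2[where f="(*)"] arg_cong2[where f="(/)"] sum.cong)

section \<open>Orthogonal maps of Gaussian vectors, and their action on the rows and columns of an
  array\<close>

definition orthonormal :: "'i set \<Rightarrow> ('i \<Rightarrow> 'i \<Rightarrow> real) \<Rightarrow> bool" where
  "orthonormal I q \<longleftrightarrow> (\<forall>k\<in>I. \<forall>l\<in>I. (\<Sum>i\<in>I. q k i * q l i) = (if k = l then 1 else 0))"

text \<open>The family \<open>q\<close> lists the columns of the matrix: \<open>q k\<close> is the
  image of the k-th basis vector. Abstract index sets allow pairs of indices, so the same result
  covers maps of matrices.\<close>

definition lin_comb :: "'i set \<Rightarrow> ('i \<Rightarrow> 'i \<Rightarrow> real) \<Rightarrow> ('i \<Rightarrow> real) \<Rightarrow> 'i \<Rightarrow> real" where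
  "lin_comb I q g = (\<lambda>i\<in>I. \<Sum>k\<in>I. g k * q k i)"

text \<open>As in the QR decomposition, an orthogonal map is a product of reflections, each of which
  moves one more basis vector into place.\<close>

theorem preserves_lin_comb:
  assumes I: "finite I" and q: "orthonormal I q"
  shows "preserves (gauss I) (lin_comb I q)"
  using q
proof (induction "card {k\<in>I. \<exists>i\<in>I. q k i \<noteq> (if i = k then 1 else 0)}" arbitrary: q rule: less_induct)
  case less
  define \<delta> :: "'a \<Rightarrow> 'a \<Rightarrow> real" where "\<delta> k i = (if i = k then 1 else 0)" for k i
  define S where "S q = {k\<in>I. \<exists>i\<in>I. q k i \<noteq> \<delta> k i}" for q
  have fS: "finite (S q)" for q using I by (simp add: S_def)
  show ?case
  proof (cases "S q = {}")
    case True
    have "lin_comb I q g = g" if "g \<in> space (gauss I)" for g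
    proof
      fix i
      show "lin_comb I q g i = g i"
      proof (cases "i \<in> I")
        case True
        then have "g k * q k i = (if k = i then g k else 0)" if "k \<in> I" for k
          using \<open>S q = {}\<close> that by (auto simp: S_def \<delta>_def)
        then show ?thesis using True I by (simp add: lin_comb_def)
      next
        case False
        then show ?thesis using that by (auto simp: lin_comb_def space_PiM PiE_def extensional_def)
      qed
    qed
    then show ?thesis using preserves_id by (subst preserves_cong[where T="\<lambda>x. x"]) auto
  next
    case False
    then obtain k where k: "k \<in> S q" by auto
    then have kI: "k \<in> I" by (simp add: S_def)
    \<comment> \<open>The difference of the unit vectors \<open>q k\<close> and
      \<open>\<delta> k\<close> is the normal vector of the reflection that exchanges them.\<close>
    define u where "u i = q k i - \<delta> k i" for i
    define q' where "q' l = reflect I u (q l)" for l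
    have qq: "(\<Sum>i\<in>I. q j i * q l i) = (if j = l then 1 else 0)" if "j \<in> I" "l \<in> I" for j l
      using less.prems that by (simp add: orthonormal_def)
    have \<delta>: "(\<Sum>i\<in>I. \<delta> l i * h i) = h l" if "l \<in> I" for l h
      using that I by (subst sum.remove[of I l]) (auto simp: \<delta>_def intro!: sum.neutral)
    have qk2: "(\<Sum>i\<in>I. q k i * q k i) = 1" using qq[OF kI kI] by simp
    have N: "(\<Sum>i\<in>I. (u i)\<^sup>2) = 2 - 2 * q k k"
    proof -
      have "(\<Sum>i\<in>I. (u i)\<^sup>2) = (\<Sum>i\<in>I. q k i * q k i - 2 * (\<delta> k i * q k i) + \<delta> k i * \<delta> k i)"
        by (intro sum.cong refl) (simp add: u_def power2_eq_square algebra_simps)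
      also have "\<dots> = 2 - 2 * q k k"
        using qk2 \<delta>[OF kI] by (simp add: sum.distrib sum_subtractf sum_distrib_left[symmetric] \<delta>_def[of k k])
      finally show ?thesis .
    qed
    have uq: "(\<Sum>i\<in>I. u i * q k i) = 1 - q k k"
      using qk2 \<delta>[OF kI, of "q k"] by (simp add: u_def left_diff_distrib sum_subtractf)
    have "(\<Sum>i\<in>I. (u i)\<^sup>2) \<noteq> 0"
      using k I by (auto simp: sum_nonneg_eq_0_iff S_def u_def)
    then have "2 * (\<Sum>i\<in>I. u i * q k i) / (\<Sum>i\<in>I. (u i)\<^sup>2) = 1"
      unfolding N uq by (simp add: field_simps)
    then have q'k: "q' k i = \<delta> k i" if "i \<in> I" for i
      using that by (simp only: q'_def reflect_apply) (simp add: u_def)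
    \<comment> \<open>Basis vectors already in place stay there: such a
      \<open>q l = \<delta> l\<close> is orthogonal to both \<open>q k\<close> and
      \<open>\<delta> k\<close>, hence to u. So the number of misplaced vectors strictly
      decreases.\<close>
    have q'l: "q' l i = \<delta> l i" if l: "l \<in> I" "l \<notin> S q" and i: "i \<in> I" for l i
    proof -
      have ql: "q l j = \<delta> l j" if "j \<in> I" for j using l that by (auto simp: S_def)
      have "l \<noteq> k" using l k by auto
      have "(\<Sum>i\<in>I. u i * q l i) = (\<Sum>i\<in>I. q k i * q l i) - (\<Sum>i\<in>I. \<delta> k i * q l i)"
        by (simp add: u_def left_diff_distrib sum_subtractf)
      also have "\<dots> = 0" using qq[OF kI l(1)] \<delta>[OF kI] ql[OF kI] \<open>l \<noteq> k\<close> by (simp add: \<delta>_def)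
      finally show ?thesis using i ql by (simp add: q'_def reflect_apply)
    qed
    have "S q' \<subseteq> S q - {k}"
      using q'k q'l unfolding S_def by fastforce
    then have "card (S q') < card (S q)"
      using fS k by (meson card_Diff1_less card_mono finite_Diff le_less_trans)
    moreover have "orthonormal I q'"
      using qq by (simp add: orthonormal_def q'_def sum_reflect[OF I])
    ultimately have IH: "preserves (gauss I) (lin_comb I q')"
      using less.hyps by (simp add: S_def \<delta>_def)
    have "lin_comb I q g = reflect I u (lin_comb I q' g)" for g
    proof
      fix i
      show "lin_comb I q g i = reflect I u (lin_comb I q' g) i"
      proof (cases "i \<in> I")
        case True
        have "reflect I u (lin_comb I q' g) = reflect I u (\<lambda>j. \<Sum>l\<in>I. g l * q' l j)"
          by (rule reflect_cong) (simp add: lin_comb_def)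
        then have "reflect I u (lin_comb I q' g) i = (\<Sum>l\<in>I. g l * reflect I u (q' l) i)"
          using reflect_sum[OF I True, of u g q' I] by simp
        also have "\<dots> = (\<Sum>l\<in>I. g l * q l i)"
          by (simp add: q'_def reflect_reflect[OF I True])
        finally show ?thesis using True by (simp add: lin_comb_def)
      qed (simp add: lin_comb_def reflect_def)
    qed
    then have "lin_comb I q = (\<lambda>g. reflect I u (lin_comb I q' g))" by auto
    then show ?thesis using preserves_comp[OF preserves_reflect[OF I] IH] by simp
  qed
qed

text \<open>Inner products of elementary tensors factor. With the identity as one factor, an
  orthogonal map acting on all columns, or on all rows, of a Gaussian array becomes an orthogonal
  map of the flattened array.\<close>

lemma orthonormal_kronecker:
  assumes "orthonormal K q" "orthonormal L r"
  shows "orthonormal (K \<times> L) (\<lambda>(k, l) (i, j). q k i * r l j)"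
proof -
  have "(\<Sum>(i, j)\<in>K \<times> L. q k i * r l j * (q k' i * r l' j)) = (\<Sum>i\<in>K. q k i * q k' i) * (\<Sum>j\<in>L. r l j * r l' j)"
    for k l k' l'
    by (simp add: sum_product sum.cartesian_product) (simp add: ac_simps)
  then show ?thesis
    using assms by (auto simp: orthonormal_def split_beta')
qed

lemma orthonormal_id: "finite K \<Longrightarrow> orthonormal K (\<lambda>k i. if k = i then 1 else 0)"
  by (auto simp: orthonormal_def if_distribR if_distrib[of "\<lambda>x. _ * x"] cong: if_cong)

lemma orthonormal_reflect:
  assumes "finite K"
  shows "orthonormal K (\<lambda>k. reflect K u (\<lambda>i. if k = i then 1 else 0))"
  using orthonormal_id[OF assms] by (simp add: orthonormal_def sum_reflect[OF assms])

lemma lin_comb_kronecker: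
  assumes "(i, j) \<in> K \<times> L"
  shows "lin_comb (K \<times> L) (\<lambda>(k, l) (i, j). q k i * r l j) g (i, j) = (\<Sum>k\<in>K. \<Sum>l\<in>L. g (k, l) * (q k i * r l j))"
  using assms by (auto simp: lin_comb_def sum.cartesian_product intro!: sum.cong)

lemma preserves_kronecker_left:
  assumes "finite K" "finite L" "orthonormal K q"
  shows "preserves (gauss (K \<times> L)) (\<lambda>g. \<lambda>(i, j)\<in>K \<times> L. \<Sum>k\<in>K. g (k, j) * q k i)"
proof -
  have "(\<lambda>(i, j)\<in>K \<times> L. \<Sum>k\<in>K. g (k, j) * q k i)
      = lin_comb (K \<times> L) (\<lambda>(k, l) (i, j). q k i * (if l = j then 1 else 0)) g" for g
  proof
    fix x :: "'a \<times> 'b"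
    obtain i j where [simp]: "x = (i, j)" by fastforce
    show "(\<lambda>(i, j)\<in>K \<times> L. \<Sum>k\<in>K. g (k, j) * q k i) x
      = lin_comb (K \<times> L) (\<lambda>(k, l) (i, j). q k i * (if l = j then 1 else 0)) g x"
    proof (cases "(i, j) \<in> K \<times> L")
      case True
      then have "(\<Sum>l\<in>L. g (k, l) * (q k i * (if l = j then 1 else 0))) = g (k, j) * q k i" for k
        using assms(2) by (subst sum.remove[of L j]) (auto intro!: sum.neutral)
      with True show ?thesis by (simp add: lin_comb_kronecker)
    qed (auto simp: lin_comb_def)
  qed
  then show ?thesis
    using preserves_lin_comb[OF _ orthonormal_kronecker[OF assms(3) orthonormal_id[OF assms(2)]]] assms by simp
qed

lemma preserves_kronecker_right:
  assumes "finite K" "finite L" "orthonormal L r"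
  shows "preserves (gauss (K \<times> L)) (\<lambda>g. \<lambda>(i, j)\<in>K \<times> L. \<Sum>l\<in>L. g (i, l) * r l j)"
proof -
  have "(\<lambda>(i, j)\<in>K \<times> L. \<Sum>l\<in>L. g (i, l) * r l j)
      = lin_comb (K \<times> L) (\<lambda>(k, l) (i, j). (if k = i then 1 else 0) * r l j) g" for g
  proof
    fix x :: "'a \<times> 'b"
    obtain i j where [simp]: "x = (i, j)" by fastforce
    show "(\<lambda>(i, j)\<in>K \<times> L. \<Sum>l\<in>L. g (i, l) * r l j) x
      = lin_comb (K \<times> L) (\<lambda>(k, l) (i, j). (if k = i then 1 else 0) * r l j) g x"
    proof (cases "(i, j) \<in> K \<times> L")
      case True
      then have "(\<Sum>k\<in>K. g (k, l) * ((if k = i then 1 else 0) * r l j)) = g (i, l) * r l j" for l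
        using assms(1) by (subst sum.remove[of K i]) (auto intro!: sum.neutral)
      with True show ?thesis by (simp add: lin_comb_kronecker sum.swap[of _ L K])
    qed (auto simp: lin_comb_def)
  qed
  then show ?thesis
    using preserves_lin_comb[OF _ orthonormal_kronecker[OF orthonormal_id[OF assms(1)] assms(3)]] assms by simp
qed

section \<open>Second moments and product decompositions\<close>

lemma std_normal_moments:
  "integrable std_normal_distribution (\<lambda>x::real. x ^ k)"
  "(\<integral>x. x \<partial>std_normal_distribution) = 0"
  "(\<integral>x. x\<^sup>2 \<partial>std_normal_distribution) = 1"
  "(\<integral>x. x ^ 3 \<partial>std_normal_distribution) = 0"
  "(\<integral>x. x ^ 4 \<partial>std_normal_distribution) = 3"
proof -
  show "integrable std_normal_distribution (\<lambda>x::real. x ^ k)"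
    by (rule integrable_std_normal_distribution_moment)
  show "(\<integral>x. x \<partial>std_normal_distribution) = 0"
    using integral_std_normal_distribution_moment_odd[of 1] by simp
  show "(\<integral>x. x ^ 3 \<partial>std_normal_distribution) = 0"
    using integral_std_normal_distribution_moment_odd[of 3] by simp
  show "(\<integral>x. x\<^sup>2 \<partial>std_normal_distribution) = 1"
    using std_normal_distribution_even_moments(1)[of 1] by (simp add: fact_numeral)
  show "(\<integral>x. x ^ 4 \<partial>std_normal_distribution) = 3"
    using std_normal_distribution_even_moments(1)[of 2] by (simp add: fact_numeral)
qed

text \<open>\<open>x^2 - 1\<close> and \<open>x\<close> are the Hermite polynomials of degrees 2 and
  1: centred, orthogonal under the normal law, with squared norms 2 and 1.\<close>

lemma std_normal_quadratic:
  fixes a b :: real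
  shows "integrable std_normal_distribution (\<lambda>x. a * (x\<^sup>2 - 1) + b * x)"
    and "(\<integral>x. a * (x\<^sup>2 - 1) + b * x \<partial>std_normal_distribution) = 0"
    and "integrable std_normal_distribution (\<lambda>x. (a * (x\<^sup>2 - 1) + b * x)\<^sup>2)"
    and "(\<integral>x. (a * (x\<^sup>2 - 1) + b * x)\<^sup>2 \<partial>std_normal_distribution) = 2 * a\<^sup>2 + b\<^sup>2"
proof -
  note int [simp] = std_normal_moments(1)[of 1, simplified] std_normal_moments(1)[of 2]
    std_normal_moments(1)[of 3] std_normal_moments(1)[of 4]
  have sq: "(a * (x\<^sup>2 - 1) + b * x)\<^sup>2 = a\<^sup>2 * x ^ 4 + 2 * a * b * x ^ 3 + (b\<^sup>2 - 2 * a\<^sup>2) * x\<^sup>2 - 2 * a * b * x + a\<^sup>2" for x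
    by (simp add: power2_eq_square power3_eq_cube power4_eq_xxxx algebra_simps)
  show "integrable std_normal_distribution (\<lambda>x. a * (x\<^sup>2 - 1) + b * x)" by simp
  show "(\<integral>x. a * (x\<^sup>2 - 1) + b * x \<partial>std_normal_distribution) = 0"
    by (simp add: std_normal_moments std_normal.prob_space[simplified])
  show "integrable std_normal_distribution (\<lambda>x. (a * (x\<^sup>2 - 1) + b * x)\<^sup>2)" unfolding sq by simp
  show "(\<integral>x. (a * (x\<^sup>2 - 1) + b * x)\<^sup>2 \<partial>std_normal_distribution) = 2 * a\<^sup>2 + b\<^sup>2"
    unfolding sq by (simp add: std_normal_moments std_normal.prob_space[simplified])
qed

lemma (in prob_space) nn_integral_square_shift:
  fixes f :: "'a \<Rightarrow> real"
  assumes "integrable M f" "expectation f = 0" "integrable M (\<lambda>x. (f x)\<^sup>2)"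
  shows "(\<integral>\<^sup>+x. ennreal ((t + f x)\<^sup>2) \<partial>M) = ennreal (t\<^sup>2 + expectation (\<lambda>x. (f x)\<^sup>2))"
proof -
  have "(\<integral>\<^sup>+x. ennreal ((t + f x)\<^sup>2) \<partial>M) = ennreal (expectation (\<lambda>x. (t + f x)\<^sup>2))"
  proof (rule nn_integral_eq_integral)
    show "integrable M (\<lambda>x. (t + f x)\<^sup>2)" using assms by (simp add: power2_sum)
  qed simp
  also have "expectation (\<lambda>x. (t + f x)\<^sup>2) = t\<^sup>2 + expectation (\<lambda>x. (f x)\<^sup>2)"
    using assms by (simp add: power2_sum prob_space)
  finally show ?thesis .
qed

text \<open>The variance of a sum of independent centred terms is additive. When one coordinate is
  integrated out, \<open>t\<close> plus the rest of the sum acts as a constant shift and the cross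
  term vanishes by centring.\<close>

lemma nn_integral_PiM_square_sum:
  fixes f :: "'i \<Rightarrow> 'a \<Rightarrow> real"
  assumes N: "prob_space N" and I: "finite I"
    and f: "\<And>i. i \<in> I \<Longrightarrow> integrable N (f i)" "\<And>i. i \<in> I \<Longrightarrow> (\<integral>x. f i x \<partial>N) = 0"
      "\<And>i. i \<in> I \<Longrightarrow> integrable N (\<lambda>x. (f i x)\<^sup>2)"
  shows "(\<integral>\<^sup>+g. ennreal ((t + (\<Sum>i\<in>I. f i (g i)))\<^sup>2) \<partial>PiM I (\<lambda>_. N))
       = ennreal (t\<^sup>2 + (\<Sum>i\<in>I. \<integral>x. (f i x)\<^sup>2 \<partial>N))"
  using I f
proof (induction I)
  case empty
  interpret prob_space "PiM {} (\<lambda>_::'i. N)" by (intro prob_space_PiM N)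
  show ?case by (simp add: emeasure_space_1)
next
  case (insert i I)
  interpret N: prob_space N by (rule N)
  interpret product_sigma_finite "\<lambda>_::'i. N" by unfold_locales
  interpret P: prob_space "PiM I (\<lambda>_::'i. N)" by (intro prob_space_PiM N)
  have [measurable]: "f j \<in> borel_measurable N" if "j \<in> insert i I" for j
    using insert.prems(1)[OF that] by simp
  have comp: "(\<lambda>g. f j (g j)) \<in> borel_measurable (PiM J (\<lambda>_. N))" if "j \<in> J" "J \<subseteq> insert i I" for j J
    using that by (intro measurable_compose[OF measurable_component_singleton[OF that(1)]]) auto
  have m1: "(\<lambda>g. t + (\<Sum>j\<in>insert i I. f j (g j))) \<in> borel_measurable (PiM (insert i I) (\<lambda>_. N))"
    by (intro borel_measurable_add borel_measurable_sum comp) auto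
  have m2 [measurable]: "(\<lambda>g. t + (\<Sum>j\<in>I. f j (g j))) \<in> borel_measurable (PiM I (\<lambda>_. N))"
    by (intro borel_measurable_add borel_measurable_sum comp) auto
  have "(\<integral>\<^sup>+g. ennreal ((t + (\<Sum>j\<in>insert i I. f j (g j)))\<^sup>2) \<partial>PiM (insert i I) (\<lambda>_. N))
      = (\<integral>\<^sup>+g. \<integral>\<^sup>+x. ennreal ((t + (\<Sum>j\<in>insert i I. f j ((g(i := x)) j)))\<^sup>2) \<partial>N \<partial>PiM I (\<lambda>_. N))"
    using m1 insert.hyps by (intro product_nn_integral_insert) simp_all
  also have "\<dots> = (\<integral>\<^sup>+g. \<integral>\<^sup>+x. ennreal (((t + (\<Sum>j\<in>I. f j (g j))) + f i x)\<^sup>2) \<partial>N \<partial>PiM I (\<lambda>_. N))"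
  proof (intro nn_integral_cong)
    fix g x
    have "(\<Sum>j\<in>insert i I. f j ((g(i := x)) j)) = f i x + (\<Sum>j\<in>I. f j (g j))"
      using insert.hyps by (simp, intro sum.cong) auto
    then show "ennreal ((t + (\<Sum>j\<in>insert i I. f j ((g(i := x)) j)))\<^sup>2)
        = ennreal (((t + (\<Sum>j\<in>I. f j (g j))) + f i x)\<^sup>2)" by (simp add: algebra_simps)
  qed
  also have "\<dots> = (\<integral>\<^sup>+g. ennreal ((t + (\<Sum>j\<in>I. f j (g j)))\<^sup>2 + (\<integral>x. (f i x)\<^sup>2 \<partial>N)) \<partial>PiM I (\<lambda>_. N))"
    by (intro nn_integral_cong N.nn_integral_square_shift insert.prems) auto
  also have "\<dots> = (\<integral>\<^sup>+g. ennreal ((t + (\<Sum>j\<in>I. f j (g j)))\<^sup>2) + ennreal (\<integral>x. (f i x)\<^sup>2 \<partial>N) \<partial>PiM I (\<lambda>_. N))"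
    by (intro nn_integral_cong ennreal_plus) simp_all
  also have "\<dots> = (\<integral>\<^sup>+g. ennreal ((t + (\<Sum>j\<in>I. f j (g j)))\<^sup>2) \<partial>PiM I (\<lambda>_. N)) + ennreal (\<integral>x. (f i x)\<^sup>2 \<partial>N)"
    by (subst nn_integral_add) (measurable, simp add: P.emeasure_space_1)
  also have "\<dots> = ennreal (t\<^sup>2 + (\<Sum>j\<in>I. \<integral>x. (f j x)\<^sup>2 \<partial>N)) + ennreal (\<integral>x. (f i x)\<^sup>2 \<partial>N)"
    using insert by simp
  also have "\<dots> = ennreal (t\<^sup>2 + (\<Sum>j\<in>insert i I. \<integral>x. (f j x)\<^sup>2 \<partial>N))"
    using insert.hyps by (subst ennreal_plus[symmetric]) (auto intro!: sum_nonneg add_nonneg_nonneg simp: algebra_simps)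
  finally show ?case .
qed

text \<open>This identifies a Gaussian vector and an independent Gaussian array with one array
  having an extra column. It serves in both directions: to attach the noise to the design, and to
  detach the response after the two have been mixed.\<close>

lemma nn_integral_gauss_column:
  assumes K: "finite K" and L: "finite L" "l \<notin> L"
    and f [measurable]: "f \<in> borel_measurable (gauss (K \<times> insert l L))"
  shows "(\<integral>\<^sup>+g. f g \<partial>gauss (K \<times> insert l L))
       = (\<integral>\<^sup>+w. \<integral>\<^sup>+z. f (\<lambda>(i, j)\<in>K \<times> insert l L. if j = l then w i else z (i, j)) \<partial>gauss (K \<times> L) \<partial>gauss K)"
proof -
  have KL: "K \<times> insert l L = K \<times> {l} \<union> K \<times> L" by auto
  have f' [measurable]: "f \<in> borel_measurable (gauss (K \<times> {l} \<union> K \<times> L))" using f KL by simp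
  interpret P: prob_space "gauss (K \<times> L)" by (intro prob_space_PiM) unfold_locales
  have reindex: "distr (gauss K) (gauss (K \<times> {l})) (\<lambda>w. \<lambda>x\<in>K \<times> {l}. w (fst x)) = gauss (K \<times> {l})"
    by (intro distr_PiM_reindex) (auto simp: inj_on_def intro: std_normal.prob_space_axioms)
  have [measurable]: "(\<lambda>w. \<lambda>x\<in>K \<times> {l}. w (fst x)) \<in> gauss K \<rightarrow>\<^sub>M gauss (K \<times> {l})"
    by (intro measurable_restrict measurable_component_singleton) auto
  have "(\<integral>\<^sup>+g. f g \<partial>gauss (K \<times> insert l L))
      = (\<integral>\<^sup>+x. \<integral>\<^sup>+z. f (merge (K \<times> {l}) (K \<times> L) (x, z)) \<partial>gauss (K \<times> L) \<partial>gauss (K \<times> {l}))"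
    unfolding KL by (intro gauss.product_nn_integral_fold) (use K L in auto)
  also have "\<dots> = (\<integral>\<^sup>+w. \<integral>\<^sup>+z. f (merge (K \<times> {l}) (K \<times> L) (\<lambda>x\<in>K \<times> {l}. w (fst x), z)) \<partial>gauss (K \<times> L) \<partial>gauss K)"
    by (subst (1) reindex[symmetric], subst nn_integral_distr) measurable
  also have "\<dots> = (\<integral>\<^sup>+w. \<integral>\<^sup>+z. f (\<lambda>(i, j)\<in>K \<times> insert l L. if j = l then w i else z (i, j)) \<partial>gauss (K \<times> L) \<partial>gauss K)"
    using L by (intro nn_integral_cong arg_cong[where f=f]) (auto simp: merge_def fun_eq_iff)
  finally show ?thesis .
qed

text \<open>The model gives a product of row laws, while the invariance results live on the flat
  product over pairs of indices. Coordinates of the flat product are independent, hence so are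
  disjoint blocks of them, and independent rows have a product law.\<close>

lemma distr_gauss_rows:
  assumes "K \<noteq> {}" "L \<noteq> {}"
  shows "distr (gauss (K \<times> L)) (PiM K (\<lambda>_. gauss L)) (\<lambda>z. \<lambda>i\<in>K. \<lambda>j\<in>L. z (i, j)) = PiM K (\<lambda>_. gauss L)"
proof -
  interpret P: prob_space "gauss (K \<times> L)" by (intro prob_space_PiM) unfold_locales
  have comp: "(\<lambda>z. z x) \<in> gauss (K \<times> L) \<rightarrow>\<^sub>M std_normal_distribution" if "x \<in> K \<times> L" for x
    using that by (rule measurable_component_singleton)
  have ne: "K \<times> L \<noteq> {}" using assms by auto
  have "P.indep_vars (\<lambda>_. std_normal_distribution) (\<lambda>x z. z x) (K \<times> L)"
  proof (subst P.indep_vars_iff_distr_eq_PiM'[OF ne comp])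
    have "distr (gauss (K \<times> L)) (gauss (K \<times> L)) (\<lambda>z. \<lambda>x\<in>K \<times> L. z x) = distr (gauss (K \<times> L)) (gauss (K \<times> L)) (\<lambda>z. z)"
      by (intro distr_cong) (auto simp: space_PiM PiE_def extensional_restrict)
    also have "\<dots> = PiM (K \<times> L) (\<lambda>x. distr (gauss (K \<times> L)) std_normal_distribution (\<lambda>z. z x))"
      unfolding distr_id
      by (intro PiM_cong refl, subst distr_PiM_component) (auto intro: std_normal.prob_space_axioms)
    finally show "distr (gauss (K \<times> L)) (gauss (K \<times> L)) (\<lambda>z. \<lambda>x\<in>K \<times> L. z x)
        = PiM (K \<times> L) (\<lambda>x. distr (gauss (K \<times> L)) std_normal_distribution (\<lambda>z. z x))" .
  qed
  then have "P.indep_vars (\<lambda>i. gauss ({i} \<times> L)) (\<lambda>i z. restrict (\<lambda>x. z x) ({i} \<times> L)) K"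
    by (rule P.indep_vars_restrict) (auto simp: disjoint_family_on_def)
  then have "P.indep_vars (\<lambda>_. gauss L) (\<lambda>i z. \<lambda>j\<in>L. restrict (\<lambda>x. z x) ({i} \<times> L) (i, j)) K"
    by (rule P.indep_vars_compose2[where Y="\<lambda>i z. \<lambda>j\<in>L. z (i, j)"])
      (intro measurable_restrict measurable_component_singleton, auto)
  then have ind: "P.indep_vars (\<lambda>_. gauss L) (\<lambda>i z. \<lambda>j\<in>L. z (i, j)) K"
    by (rule back_subst[of "\<lambda>X. P.indep_vars _ X K"]) (auto simp: fun_eq_iff)
  have row: "(\<lambda>z. \<lambda>j\<in>L. z (i, j)) \<in> gauss (K \<times> L) \<rightarrow>\<^sub>M gauss L" if "i \<in> K" for i
    using that by (intro measurable_restrict measurable_component_singleton) auto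
  have "distr (gauss (K \<times> L)) (PiM K (\<lambda>_. gauss L)) (\<lambda>z. \<lambda>i\<in>K. \<lambda>j\<in>L. z (i, j))
      = PiM K (\<lambda>i. distr (gauss (K \<times> L)) (gauss L) (\<lambda>z. \<lambda>j\<in>L. z (i, j)))"
    using P.indep_vars_iff_distr_eq_PiM'[OF assms(1) row] ind by simp
  also have "\<dots> = PiM K (\<lambda>_. gauss L)"
    by (intro PiM_cong refl distr_PiM_reindex) (auto simp: inj_on_def intro: std_normal.prob_space_axioms)
  finally show ?thesis .
qed

lemma preserves_reflect_columns:
  assumes K: "finite K" and L: "finite L"
  shows "preserves (gauss (K \<times> L)) (\<lambda>g. \<lambda>(i, j)\<in>K \<times> L. reflect K u (\<lambda>k. g (k, j)) i)"
proof -
  have "reflect K u (\<lambda>k. g (k, j)) i = (\<Sum>k\<in>K. g (k, j) * reflect K u (\<lambda>i. if k = i then 1 else 0) i)"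
    if "i \<in> K" for g :: "'a \<times> 'b \<Rightarrow> real" and i j
  proof -
    have "reflect K u (\<lambda>k. g (k, j)) = reflect K u (\<lambda>i. \<Sum>k\<in>K. g (k, j) * (if k = i then 1 else 0))"
      using K by (intro reflect_cong) (simp add: if_distrib[of "\<lambda>x. _ * x"] cong: if_cong)
    then show ?thesis using reflect_sum[OF K that] by simp
  qed
  then have "(\<lambda>(i, j)\<in>K \<times> L. reflect K u (\<lambda>k. g (k, j)) i)
     = (\<lambda>(i, j)\<in>K \<times> L. \<Sum>k\<in>K. g (k, j) * reflect K u (\<lambda>i. if k = i then 1 else 0) i)" for g
    by (auto simp: fun_eq_iff)
  then show ?thesis
    using preserves_kronecker_left[OF K L orthonormal_reflect[OF K, of u]] by simp
qed

text \<open>Mixes two whole columns, in all rows at once; this is how the first design column and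
  the noise are turned into the response and a complementary direction.\<close>

lemma preserves_givens_columns:
  assumes K: "finite K" and L: "finite L" and l: "l \<in> L" "m \<in> L" "l \<noteq> m" and ac: "a\<^sup>2 + c\<^sup>2 = 1"
  shows "preserves (gauss (K \<times> L)) (\<lambda>g. \<lambda>(i, j)\<in>K \<times> L. givens l m a c (\<lambda>k. g (i, k)) j)"
proof -
  define r where "r k = givens l m a c (\<lambda>j. if k = j then 1 else 0)" for k
  have r: "orthonormal L r"
    using orthonormal_id[OF L] by (simp add: orthonormal_def r_def sum_givens[OF L l ac])
  have "givens l m a c (\<lambda>k. g (i, k)) j = (\<Sum>k\<in>L. g (i, k) * r k j)"
    if "j \<in> L" for g :: "'a \<times> 'b \<Rightarrow> real" and i j
  proof -
    have e: "(\<Sum>k\<in>L. g (i, k) * (if k = j then 1 else 0)) = g (i, j)" if "j \<in> L" for j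
      using that L by (simp add: if_distrib[of "\<lambda>x. _ * x"] cong: if_cong)
    show ?thesis
      using that l e[OF that] e[OF l(1)] e[OF l(2)]
      by (auto simp: r_def givens_def sum.distrib sum_subtractf algebra_simps sum_distrib_left[symmetric]) 
  qed
  then have "(\<lambda>(i, j)\<in>K \<times> L. givens l m a c (\<lambda>k. g (i, k)) j)
     = (\<lambda>(i, j)\<in>K \<times> L. \<Sum>k\<in>L. g (i, k) * r k j)" for g :: "'a \<times> 'b \<Rightarrow> real"
    by (auto simp: fun_eq_iff)
  then show ?thesis
    using preserves_kronecker_right[OF K L r] by simp
qed

section \<open>Mean squared error for a whitened design\<close>

text \<open>The estimator at response \<open>y\<close> when the design has been whitened to \<open>Z\<close>, with columns \<open>L\<close>.\<close>

definition proj_stat :: "nat \<Rightarrow> 'j set \<Rightarrow> (nat \<Rightarrow> real) \<Rightarrow> (nat \<Rightarrow> 'j \<Rightarrow> real) \<Rightarrow> real" where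
  "proj_stat n L y Z =
     ((\<Sum>j\<in>L. (\<Sum>i<n. y i * Z i j)\<^sup>2) - (\<Sum>j\<in>L. \<Sum>i<n. (Z i j)\<^sup>2) / real n * (\<Sum>i<n. (y i)\<^sup>2))
      / ((real n + 1) * (\<Sum>i<n. (y i)\<^sup>2))"

lemma proj_stat_cong:
  assumes "\<And>i. i < n \<Longrightarrow> y i = y' i" "\<And>i j. i < n \<Longrightarrow> j \<in> L \<Longrightarrow> Z i j = Z' i j"
  shows "proj_stat n L y Z = proj_stat n L y' Z'"
  using assms by (simp add: proj_stat_def)

text \<open>Numerator and denominator are both quadratic in \<open>y\<close>. This is what removes
  the unknown standard deviation of the response.\<close>

lemma proj_stat_scale:
  assumes "t \<noteq> 0"
  shows "proj_stat n L (\<lambda>i. t * y i) Z = proj_stat n L y Z"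
proof -
  have 1: "(\<Sum>i<n. (t * y i) * Z i j)\<^sup>2 = t\<^sup>2 * (\<Sum>i<n. y i * Z i j)\<^sup>2" for j
    by (simp add: power_mult_distrib[symmetric] sum_distrib_left mult.assoc)
  have 2: "(\<Sum>i<n. (t * y i)\<^sup>2) = t\<^sup>2 * (\<Sum>i<n. (y i)\<^sup>2)"
    by (simp add: power_mult_distrib sum_distrib_left)
  have "proj_stat n L (\<lambda>i. t * y i) Z = (t\<^sup>2 * ((\<Sum>j\<in>L. (\<Sum>i<n. y i * Z i j)\<^sup>2)
      - (\<Sum>j\<in>L. \<Sum>i<n. (Z i j)\<^sup>2) / real n * (\<Sum>i<n. (y i)\<^sup>2))) / (t\<^sup>2 * ((real n + 1) * (\<Sum>i<n. (y i)\<^sup>2)))"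
    unfolding proj_stat_def 1 2 by (simp only: sum_distrib_left right_diff_distrib) (simp add: ac_simps)
  also have "\<dots> = proj_stat n L y Z"
    using assms by (subst mult_divide_mult_cancel_left) (simp_all add: proj_stat_def)
  finally show ?thesis .
qed

lemma borel_measurable_proj_stat:
  assumes "\<And>i. i < n \<Longrightarrow> (\<lambda>x. y x i) \<in> borel_measurable M"
    and "\<And>i j. i < n \<Longrightarrow> j \<in> L \<Longrightarrow> (\<lambda>x. Z x i j) \<in> borel_measurable M"
  shows "(\<lambda>x. proj_stat n L (y x) (Z x)) \<in> borel_measurable M"
  unfolding proj_stat_def
  by (intro borel_measurable_divide borel_measurable_diff borel_measurable_times borel_measurable_sum
      borel_measurable_power borel_measurable_const assms) auto

text \<open>Equal norms make the sum of \<open>a\<close> and \<open>b\<close> orthogonal to their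
  difference, so the reflection along the difference carries \<open>a\<close> to \<open>b\<close>.
  If the two agree on I, the normal vector is zero there and \<open>reflect\<close> is the
  identity.\<close>

lemma reflect_exchange:
  assumes I: "finite I" and ab: "(\<Sum>k\<in>I. (a k)\<^sup>2) = (\<Sum>k\<in>I. (b k)\<^sup>2)" and i: "i \<in> I"
  shows "reflect I (\<lambda>k. a k - b k) a i = b i"
proof -
  have N: "(\<Sum>k\<in>I. (a k - b k)\<^sup>2) = 2 * (\<Sum>k\<in>I. (a k - b k) * a k)"
  proof -
    have "(\<Sum>k\<in>I. (a k - b k)\<^sup>2) = (\<Sum>k\<in>I. 2 * ((a k - b k) * a k) + (b k)\<^sup>2 - (a k)\<^sup>2)"
      by (intro sum.cong refl) (simp add: power2_eq_square algebra_simps)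
    then show ?thesis using ab by (simp add: sum.distrib sum_subtractf sum_distrib_left)
  qed
  show ?thesis
  proof (cases "(\<Sum>k\<in>I. (a k - b k)\<^sup>2) = 0")
    case True
    then have "a i = b i" using I i by (simp add: sum_nonneg_eq_0_iff)
    with True show ?thesis using i by (simp add: reflect_apply)
  next
    case False
    then show ?thesis using i by (simp add: reflect_apply N)
  qed
qed

text \<open>\<open>H\<close> reflects \<open>v\<close> onto the first axis, which diagonalises the quadratic form in the columns
  \<open>x j\<close>; the form is traceless, so centring each square costs no constant term.\<close>

lemma proj_stat_rotated:
  fixes v :: "nat \<Rightarrow> real" and x :: "'j \<Rightarrow> nat \<Rightarrow> real" and c d :: real and n :: nat and l :: 'j
  defines "r \<equiv> sqrt (\<Sum>i<n. (v i)\<^sup>2)"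
  defines "H \<equiv> reflect {..<n} (\<lambda>k. v k - (if k = 0 then r else 0))"
  defines "a i j \<equiv> ((if i = 0 then 1 else 0) - 1 / real n) * (if j = l then d\<^sup>2 else 1)"
  defines "b i j \<equiv> (if i = 0 \<and> j = l then 2 * c * d * (1 - 1 / real n) * r else 0)"
  assumes n: "1 \<le> n" and L: "finite L" "l \<in> L" and r: "r \<noteq> 0"
  shows "proj_stat n L v (\<lambda>i j. if j = l then c * v i + d * H (x l) i else H (x j) i)
    = (c\<^sup>2 * (1 - 1 / real n) * r\<^sup>2 + (\<Sum>i<n. \<Sum>j\<in>L. a i j * ((x j i)\<^sup>2 - 1) + b i j * x j i)) / (real n + 1)"
proof -
  have r2: "r\<^sup>2 = (\<Sum>i<n. (v i)\<^sup>2)" by (simp add: r_def sum_nonneg)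
  have e0: "(\<Sum>i<n. h i * (if i = 0 then r else 0)) = h 0 * r" for h
    using n by (subst sum.remove[of _ 0]) (auto intro!: sum.neutral)
  have "(\<Sum>i<n. (if i = 0 then r else 0)\<^sup>2) = r\<^sup>2"
    using e0[of "\<lambda>i. if i = 0 then r else 0"] by (simp add: power2_eq_square)
  then have Hv: "H v i = (if i = 0 then r else 0)" if "i < n" for i
    unfolding H_def using that r2 by (subst reflect_exchange) auto
  \<comment> \<open>H is an isometry and an involution, so it can be moved from y to v, where it
    produces \<open>r\<close> times the first basis vector.\<close>
  have vH: "(\<Sum>i<n. v i * H y i) = r * y 0" for y
  proof -
    have "(\<Sum>i<n. v i * H y i) = (\<Sum>i<n. H v i * H (H y) i)"
      unfolding H_def by (simp add: sum_reflect)
    also have "\<dots> = (\<Sum>i<n. (if i = 0 then r else 0) * y i)"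
      by (intro sum.cong refl) (simp add: Hv[unfolded H_def] H_def reflect_reflect)
    also have "\<dots> = r * y 0" using e0[of y] by (simp add: mult.commute)
    finally show ?thesis .
  qed
  have HH: "(\<Sum>i<n. (H y i)\<^sup>2) = (\<Sum>i<n. (y i)\<^sup>2)" for y
    unfolding H_def power2_eq_square by (simp add: sum_reflect)
  have vHl: "(\<Sum>i<n. v i * (c * v i + d * H y i)) = r * (c * r + d * y 0)" for y
  proof -
    have "(\<Sum>i<n. v i * (c * v i + d * H y i)) = c * (\<Sum>i<n. (v i)\<^sup>2) + d * (\<Sum>i<n. v i * H y i)"
      by (simp add: sum.distrib sum_distrib_left power2_eq_square algebra_simps)
    also have "\<dots> = c * r\<^sup>2 + d * (r * y 0)" by (simp only: vH r2[symmetric])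
    finally show ?thesis by (simp add: power2_eq_square algebra_simps)
  qed
  have HHl: "(\<Sum>i<n. (c * v i + d * H y i)\<^sup>2) = c\<^sup>2 * r\<^sup>2 + 2 * c * d * (r * y 0) + d\<^sup>2 * (\<Sum>i<n. (y i)\<^sup>2)" for y
  proof -
    have "(\<Sum>i<n. (c * v i + d * H y i)\<^sup>2)
        = c\<^sup>2 * (\<Sum>i<n. (v i)\<^sup>2) + 2 * c * d * (\<Sum>i<n. v i * H y i) + d\<^sup>2 * (\<Sum>i<n. (H y i)\<^sup>2)"
      unfolding sum_distrib_left sum.distrib[symmetric]
      by (intro sum.cong refl) (simp add: power2_eq_square algebra_simps)
    then show ?thesis by (simp only: vH HH r2[symmetric])
  qed
  define Z where "Z i j = (if j = l then c * v i + d * H (x l) i else H (x j) i)" for i j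
  have col: "(\<Sum>i<n. ((if i = 0 then 1 else 0) - 1 / real n) * ((y i)\<^sup>2 - 1)) = (y 0)\<^sup>2 - (\<Sum>i<n. (y i)\<^sup>2) / real n"
    for y :: "nat \<Rightarrow> real"
  proof -
    have "(\<Sum>i<n. ((if i = 0 then 1 else 0) - 1 / real n) * ((y i)\<^sup>2 - 1))
        = (\<Sum>i<n. (if i = 0 then (y 0)\<^sup>2 - 1 else 0)) - (\<Sum>i<n. ((y i)\<^sup>2 - 1)) / real n"
      unfolding sum_divide_distrib sum_subtractf[symmetric]
      by (intro sum.cong refl) (auto simp: algebra_simps diff_divide_distrib)
    also have "(\<Sum>i<n. (if i = 0 then (y 0)\<^sup>2 - 1 else 0)) = (y 0)\<^sup>2 - 1" using n by simp
    also have "(y 0)\<^sup>2 - 1 - (\<Sum>i<n. ((y i)\<^sup>2 - 1)) / real n = (y 0)\<^sup>2 - (\<Sum>i<n. (y i)\<^sup>2) / real n"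
      using n by (simp add: sum_subtractf diff_divide_distrib)
    finally show ?thesis .
  qed
  \<comment> \<open>Only column l has a component along \<open>v\<close>. Squaring
    \<open>c * r + d * x l 0\<close> and subtracting the averaged square norm yields the
    deterministic term \<open>c^2 * (1 - 1 / n) * r^2\<close>, the cross term collected in
    \<open>b\<close>, and \<open>d^2\<close> times the form of an ordinary column.\<close>
  have column: "((\<Sum>i<n. v i * Z i j) / r)\<^sup>2 - (\<Sum>i<n. (Z i j)\<^sup>2) / real n
      = (if j = l then c\<^sup>2 * (1 - 1 / real n) * r\<^sup>2 else 0) + (\<Sum>i<n. a i j * ((x j i)\<^sup>2 - 1) + b i j * x j i)" for j
  proof (cases "j = l")
    case True
    have "(\<Sum>i<n. b i l * x l i) = 2 * c * d * (1 - 1 / real n) * r * x l 0"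
      using n unfolding b_def by (subst sum.remove[of _ 0]) (auto intro!: sum.neutral)
    then have s1: "(\<Sum>i<n. a i l * ((x l i)\<^sup>2 - 1) + b i l * x l i)
        = d\<^sup>2 * ((x l 0)\<^sup>2 - (\<Sum>i<n. (x l i)\<^sup>2) / real n) + 2 * c * d * (1 - 1 / real n) * r * x l 0"
      unfolding col[symmetric] sum.distrib sum_distrib_left by (simp add: a_def algebra_simps)
    have s2: "(\<Sum>i<n. v i * Z i l) / r = c * r + d * x l 0"
      using r by (simp add: Z_def vHl)
    have s3: "(\<Sum>i<n. (Z i l)\<^sup>2) = c\<^sup>2 * r\<^sup>2 + 2 * c * d * (r * x l 0) + d\<^sup>2 * (\<Sum>i<n. (x l i)\<^sup>2)"
      by (simp add: Z_def HHl)
    show ?thesis unfolding True simp_thms if_True s1 s2 s3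
      by (simp add: divide_inverse power2_eq_square algebra_simps)
  next
    case False
    then show ?thesis using r col[of "x j"]
      by (simp add: Z_def vH HH a_def b_def)
  qed
  have "proj_stat n L v Z = (\<Sum>j\<in>L. ((\<Sum>i<n. v i * Z i j) / r)\<^sup>2 - (\<Sum>i<n. (Z i j)\<^sup>2) / real n) / (real n + 1)"
    using r n unfolding proj_stat_def r2[symmetric] power_divide sum_subtractf sum_divide_distrib[symmetric]
    by (simp add: field_simps)
  also have "\<dots> = (c\<^sup>2 * (1 - 1 / real n) * r\<^sup>2 + (\<Sum>i<n. \<Sum>j\<in>L. a i j * ((x j i)\<^sup>2 - 1) + b i j * x j i)) / (real n + 1)"
    unfolding column using L by (subst sum.distrib, subst sum.swap) simp
  finally show ?thesis by (simp only: Z_def[abs_def])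
qed

text \<open>With \<open>v\<close> fixed the error is an affine combination of independent Hermite
  terms, so its second moment is the squared constant plus the sum of \<open>2 * a^2 + b^2\<close>.
  The deviation of the squared norm of \<open>v\<close> from n is kept as a sum of centred terms
  \<open>(v i)^2 - 1\<close>, so that the later integral over \<open>v\<close> is again an instance
  of the sum formula.\<close>

lemma nn_integral_proj_stat_given_response:
  fixes v :: "nat \<Rightarrow> real" and c d :: real
  assumes n: "1 \<le> n" and L: "finite L" "l \<in> L" and cd: "c\<^sup>2 + d\<^sup>2 = 1"
  shows "(\<integral>\<^sup>+z. ennreal ((proj_stat n L v (\<lambda>i j. if j = l then c * v i + d * z (i, j) else z (i, j)) - c\<^sup>2)\<^sup>2)
            \<partial>gauss ({..<n} \<times> L))
      \<le> ennreal ((2 * (\<Sum>i<n. (v i)\<^sup>2 - 1)\<^sup>2 + (\<Sum>i<n. (v i)\<^sup>2) + (8 + 2 * real (card L))) / (real n + 1)\<^sup>2)"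
    (is "?lhs \<le> ennreal (?B / _)")
proof -
  define r where "r = sqrt (\<Sum>i<n. (v i)\<^sup>2)"
  have r2: "r\<^sup>2 = (\<Sum>i<n. (v i)\<^sup>2)" by (simp add: r_def sum_nonneg)
  have Q: "(\<Sum>i<n. (v i)\<^sup>2 - 1) = r\<^sup>2 - real n" by (simp add: sum_subtractf r2)
  have c1: "c\<^sup>2 \<le> 1" and d1: "d\<^sup>2 \<le> 1" using cd by (metis le_add_same_cancel1 le_add_same_cancel2 zero_le_power2)+
  interpret P: prob_space "gauss ({..<n} \<times> L)" by (intro prob_space_PiM) unfold_locales
  show ?thesis
  proof (cases "r = 0")
    case True
    \<comment> \<open>Here \<open>proj_stat\<close> is 0 by division by zero, and the first summand of the bound is \<open>2 n\<^sup>2\<close>.\<close>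
    then have z: "(\<Sum>i<n. (v i)\<^sup>2) = 0" using r2 by simp
    have "?lhs = ennreal ((c\<^sup>2)\<^sup>2)" by (simp add: proj_stat_def z P.emeasure_space_1)
    also have "\<dots> \<le> ennreal (?B / (real n + 1)\<^sup>2)"
    proof (rule ennreal_leI)
      have "(c\<^sup>2)\<^sup>2 \<le> 1" by (rule power_le_one) (use c1 in auto)
      moreover have "(real n + 1)\<^sup>2 \<le> ?B"
      proof -
        have "0 \<le> (real n - 1)\<^sup>2" by simp
        then have "(real n + 1)\<^sup>2 \<le> 2 * (real n)\<^sup>2 + 8" by (simp add: power2_eq_square algebra_simps)
        then show ?thesis using True unfolding Q z by simp
      qed
      then have "1 \<le> ?B / (real n + 1)\<^sup>2" by (subst le_divide_eq_1_pos) (auto simp: add_pos_nonneg)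
      ultimately show "(c\<^sup>2)\<^sup>2 \<le> ?B / (real n + 1)\<^sup>2" by linarith
    qed
    finally show ?thesis .
  next
    case False
    define H where "H = reflect {..<n} (\<lambda>k. v k - (if k = 0 then r else 0))"
    define a where "a i j = ((if i = 0 then 1 else 0) - 1 / real n) * (if j = l then d\<^sup>2 else 1)" for i :: nat and j
    define b where "b i j = (if i = 0 \<and> j = l then 2 * c * d * (1 - 1 / real n) * r else 0)" for i :: nat and j
    \<comment> \<open>The constant term left after subtracting \<open>c^2 * (n + 1)\<close>. Writing
      \<open>r^2 = (r^2 - n) + n\<close> gives \<open>(n - 1) - (n + 1) = -2\<close>: the estimator
      has a small bias, and the rest is the fluctuation of \<open>r^2\<close>.\<close>
    define A where "A = c\<^sup>2 * ((1 - 1 / real n) * (r\<^sup>2 - real n) - 2)"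
    define F where "F z = proj_stat n L v (\<lambda>i j. if j = l then c * v i + d * z (i, j) else z (i, j))" for z
    define T where "T g = (\<lambda>(i, j)\<in>{..<n} \<times> L. H (\<lambda>k. g (k, j)) i)" for g
    have T: "preserves (gauss ({..<n} \<times> L)) T"
      unfolding T_def H_def by (rule preserves_reflect_columns) (use L in auto)
    have comp: "(\<lambda>z. z x) \<in> borel_measurable (gauss ({..<n} \<times> L))" if "x \<in> {..<n} \<times> L" for x
      using measurable_component_singleton[OF that, of "\<lambda>_. std_normal_distribution"] by simp
    have F [measurable]: "F \<in> borel_measurable (gauss ({..<n} \<times> L))"
      unfolding F_def by (rule borel_measurable_proj_stat) (auto intro!: comp simp: if_distrib[of "\<lambda>f. f _"])
    have FT: "(F (T z) - c\<^sup>2)\<^sup>2 = (A + (\<Sum>x\<in>{..<n} \<times> L. case x of (i, j) \<Rightarrow> a i j * ((z x)\<^sup>2 - 1) + b i j * z x))\<^sup>2 / (real n + 1)\<^sup>2" for z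
    proof -
      have "F (T z) = proj_stat n L v (\<lambda>i j. if j = l then c * v i + d * H (\<lambda>k. z (k, l)) i else H (\<lambda>k. z (k, j)) i)"
        unfolding F_def by (rule proj_stat_cong) (auto simp: T_def)
      also have "\<dots> = (c\<^sup>2 * (1 - 1 / real n) * r\<^sup>2 + (\<Sum>i<n. \<Sum>j\<in>L. a i j * ((z (i, j))\<^sup>2 - 1) + b i j * z (i, j))) / (real n + 1)"
        unfolding a_def b_def r_def H_def
        by (rule proj_stat_rotated[OF n L]) (use False in \<open>simp add: r_def\<close>)
      also have "\<dots> - c\<^sup>2 = (A + (\<Sum>i<n. \<Sum>j\<in>L. a i j * ((z (i, j))\<^sup>2 - 1) + b i j * z (i, j))) / (real n + 1)"
      proof -
        have "(X + S) / (real n + 1) - c\<^sup>2 = (X - c\<^sup>2 * (real n + 1) + S) / (real n + 1)" for X S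
          by (simp add: field_simps)
        moreover have "c\<^sup>2 * (1 - 1 / real n) * r\<^sup>2 - c\<^sup>2 * (real n + 1) = A"
          using n by (simp add: A_def field_simps)
        ultimately show ?thesis by simp
      qed
      finally show ?thesis by (simp add: sum.cartesian_product power_divide split_beta')
    qed
    have "?lhs = (\<integral>\<^sup>+z. ennreal ((F z - c\<^sup>2)\<^sup>2) \<partial>gauss ({..<n} \<times> L))" by (simp add: F_def)
    also have "\<dots> = (\<integral>\<^sup>+z. ennreal ((F (T z) - c\<^sup>2)\<^sup>2) \<partial>gauss ({..<n} \<times> L))"
      by (rule preserves_nn_integral[OF T, symmetric]) measurable
    also have "\<dots> = (\<integral>\<^sup>+z. ennreal (1 / (real n + 1)\<^sup>2) * ennreal ((A + (\<Sum>x\<in>{..<n} \<times> L. case x of (i, j) \<Rightarrow> a i j * ((z x)\<^sup>2 - 1) + b i j * z x))\<^sup>2) \<partial>gauss ({..<n} \<times> L))"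
      unfolding FT by (intro nn_integral_cong) (simp add: ennreal_mult[symmetric])
    also have "\<dots> = ennreal (1 / (real n + 1)\<^sup>2) * (\<integral>\<^sup>+z. ennreal ((A + (\<Sum>x\<in>{..<n} \<times> L. case x of (i, j) \<Rightarrow> a i j * ((z x)\<^sup>2 - 1) + b i j * z x))\<^sup>2) \<partial>gauss ({..<n} \<times> L))"
      by (intro nn_integral_cmult measurable_compose[OF _ measurable_ennreal] borel_measurable_power
          borel_measurable_add borel_measurable_sum)
        (auto intro!: borel_measurable_add borel_measurable_times borel_measurable_diff borel_measurable_power comp)
    also have "(\<integral>\<^sup>+z. ennreal ((A + (\<Sum>x\<in>{..<n} \<times> L. case x of (i, j) \<Rightarrow> a i j * ((z x)\<^sup>2 - 1) + b i j * z x))\<^sup>2) \<partial>gauss ({..<n} \<times> L))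
        = ennreal (A\<^sup>2 + (\<Sum>x\<in>{..<n} \<times> L. \<integral>y. (case x of (i, j) \<Rightarrow> a i j * (y\<^sup>2 - 1) + b i j * y)\<^sup>2 \<partial>std_normal_distribution))"
      by (rule nn_integral_PiM_square_sum[where f="\<lambda>x y. case x of (i, j) \<Rightarrow> a i j * (y\<^sup>2 - 1) + b i j * y"])
        (use L in \<open>auto intro: std_normal.prob_space_axioms std_normal_quadratic\<close>)
    also have "(\<Sum>x\<in>{..<n} \<times> L. \<integral>y. (case x of (i, j) \<Rightarrow> a i j * (y\<^sup>2 - 1) + b i j * y)\<^sup>2 \<partial>std_normal_distribution)
        = (\<Sum>i<n. \<Sum>j\<in>L. 2 * (a i j)\<^sup>2 + (b i j)\<^sup>2)"
      by (simp add: split_beta' std_normal_quadratic sum.cartesian_product)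
    also have "ennreal (1 / (real n + 1)\<^sup>2) * ennreal (A\<^sup>2 + (\<Sum>i<n. \<Sum>j\<in>L. 2 * (a i j)\<^sup>2 + (b i j)\<^sup>2))
        = ennreal ((A\<^sup>2 + (\<Sum>i<n. \<Sum>j\<in>L. 2 * (a i j)\<^sup>2 + (b i j)\<^sup>2)) / (real n + 1)\<^sup>2)"
      by (subst ennreal_mult[symmetric]) (auto intro!: add_nonneg_nonneg sum_nonneg)
    also have "\<dots> \<le> ennreal (?B / (real n + 1)\<^sup>2)"
    proof (intro ennreal_leI divide_right_mono)
      have n1: "0 \<le> 1 - 1 / real n" "1 - 1 / real n \<le> 1" using n by auto
      have "(\<Sum>i<n. \<Sum>j\<in>L. (b i j)\<^sup>2) = (2 * c * d * (1 - 1 / real n) * r)\<^sup>2"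
      proof -
        have "(\<Sum>j\<in>L. (b i j)\<^sup>2) = (if i = 0 then (2 * c * d * (1 - 1 / real n) * r)\<^sup>2 else 0)" for i
          using L by (subst sum.remove[of L l]) (auto simp: b_def intro!: sum.neutral)
        then show ?thesis using n by simp
      qed
      also have "\<dots> = (4 * (c\<^sup>2 * d\<^sup>2)) * (1 - 1 / real n)\<^sup>2 * r\<^sup>2" by (simp add: power_mult_distrib)
      also have "\<dots> \<le> 1 * 1 * r\<^sup>2"
      proof (intro mult_mono)
        have "(c\<^sup>2 - d\<^sup>2)\<^sup>2 \<ge> 0" by simp
        then have "4 * (c\<^sup>2 * d\<^sup>2) \<le> (c\<^sup>2 + d\<^sup>2)\<^sup>2" by (simp add: power2_eq_square algebra_simps)
        then show "4 * (c\<^sup>2 * d\<^sup>2) \<le> 1" by (simp add: cd)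
        show "(1 - 1 / real n)\<^sup>2 \<le> 1" using n1 by (intro power_le_one)
      qed auto
      finally have b: "(\<Sum>i<n. \<Sum>j\<in>L. (b i j)\<^sup>2) \<le> r\<^sup>2" by simp
      \<comment> \<open>The squared Frobenius norm of a rank-one projection minus
        \<open>1 / n\<close> times the identity; it equals \<open>1 - 1 / n\<close>.\<close>
      have \<lambda>: "(\<Sum>i<n. ((if i = 0 then 1 else 0) - 1 / real n)\<^sup>2) \<le> 1"
      proof -
        have "(\<Sum>i<n. ((if i = 0 then 1 else 0) - 1 / real n)\<^sup>2)
            = (\<Sum>i<n. (if i = 0 then 1 - 2 / real n else 0)) + (\<Sum>i<n. 1 / (real n)\<^sup>2)"
          unfolding sum.distrib[symmetric]
          by (intro sum.cong refl) (auto simp: power2_eq_square algebra_simps)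
        also have "\<dots> = 1 - 1 / real n" using n by (simp add: power2_eq_square)
        finally show ?thesis by simp
      qed
      have "(\<Sum>i<n. \<Sum>j\<in>L. (a i j)\<^sup>2) = (\<Sum>i<n. ((if i = 0 then 1 else 0) - 1 / real n)\<^sup>2) * (\<Sum>j\<in>L. (if j = l then d\<^sup>2 else 1)\<^sup>2)"
        by (simp only: a_def power_mult_distrib sum_product)
      also have "\<dots> \<le> 1 * real (card L)"
      proof (intro mult_mono \<lambda>)
        have "(\<Sum>j\<in>L. (if j = l then d\<^sup>2 else 1)\<^sup>2) \<le> (\<Sum>j\<in>L. 1)"
          by (intro sum_mono, rule power_le_one) (use d1 in auto)
        then show "(\<Sum>j\<in>L. (if j = l then d\<^sup>2 else 1)\<^sup>2) \<le> real (card L)" by simp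
      qed (auto intro: sum_nonneg)
      finally have a: "(\<Sum>i<n. \<Sum>j\<in>L. (a i j)\<^sup>2) \<le> real (card L)" by simp
      have "A\<^sup>2 = (c\<^sup>2)\<^sup>2 * ((1 - 1 / real n) * (r\<^sup>2 - real n) - 2)\<^sup>2" by (simp add: A_def power_mult_distrib)
      also have "\<dots> \<le> 1 * (2 * ((1 - 1 / real n) * (r\<^sup>2 - real n))\<^sup>2 + 8)"
      proof (intro mult_mono)
        show "(c\<^sup>2)\<^sup>2 \<le> 1" by (rule power_le_one) (use c1 in auto)
        \<comment> \<open>For a real number t,
          \<open>2 * t^2 + 8 - (t - 2)^2 = (t + 2)^2\<close>.\<close>
        have "0 \<le> ((1 - 1 / real n) * (r\<^sup>2 - real n) + 2)\<^sup>2" by simp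
        then show "((1 - 1 / real n) * (r\<^sup>2 - real n) - 2)\<^sup>2 \<le> 2 * ((1 - 1 / real n) * (r\<^sup>2 - real n))\<^sup>2 + 8"
          unfolding power2_sum power2_diff by simp
      qed auto
      also have "\<dots> \<le> 2 * (r\<^sup>2 - real n)\<^sup>2 + 8"
        using n1 by (simp add: power_mult_distrib mult_left_le_one_le power_le_one)
      finally have A: "A\<^sup>2 \<le> 2 * (r\<^sup>2 - real n)\<^sup>2 + 8" .
      show "A\<^sup>2 + (\<Sum>i<n. \<Sum>j\<in>L. 2 * (a i j)\<^sup>2 + (b i j)\<^sup>2) \<le> ?B"
        unfolding Q r2[symmetric] sum.distrib sum_distrib_left[symmetric] using a b A by linarith
    qed simp
    finally show ?thesis .
  qed
qed

text \<open>The noise is adjoined as column p of the design array, which puts it on an equal footing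
  with column 0. What remains after conditioning is the average over \<open>v\<close>, with E
  \<open>(|v|^2 - n)^2 = 2 * n\<close> and E \<open>|v|^2 = n\<close>.\<close>

lemma nn_integral_proj_stat:
  fixes c d :: real
  assumes n: "1 \<le> n" and np: "n \<le> p" and cd: "c\<^sup>2 + d\<^sup>2 = 1"
  shows "(\<integral>\<^sup>+w. \<integral>\<^sup>+z. ennreal ((proj_stat n {..<p} (\<lambda>i. c * z (i, 0) - d * w i) (\<lambda>i j. z (i, j)) - c\<^sup>2)\<^sup>2)
            \<partial>gauss ({..<n} \<times> {..<p}) \<partial>gauss {..<n})
      \<le> ennreal (15 * real p / (real n)\<^sup>2)"
proof -
  define I where "I = {..<n} \<times> insert p {..<p}"
  define F where "F g = ennreal ((proj_stat n {..<p} (\<lambda>i. c * g (i, 0) - d * g (i, p)) (\<lambda>i j. g (i, j)) - c\<^sup>2)\<^sup>2)"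
    for g :: "nat \<times> nat \<Rightarrow> real"
  \<comment> \<open>The planar reflection with rows (d, c) and (c, -d) on columns 0 and p. Since it
    is its own inverse, substituting it makes the response \<open>c * z (i, 0) - d * w i\<close>
    equal to the plain column p, while column 0 becomes
    \<open>d * z (i, 0) + c * v i\<close>.\<close>
  define T where "T g = (\<lambda>(i, j)\<in>I. givens 0 p d c (\<lambda>k. g (i, k)) j)" for g :: "nat \<times> nat \<Rightarrow> real"
  define col where "col w z = (\<lambda>(i, j)\<in>I. if j = p then w i else z (i, j))" for w :: "nat \<Rightarrow> real" and z
  have p: "0 < p" using n np by simp
  have comp: "(\<lambda>g. g x) \<in> borel_measurable (gauss I)" if "x \<in> I" for x
    using measurable_component_singleton[OF that, of "\<lambda>_. std_normal_distribution"] by simp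
  have F [measurable]: "F \<in> borel_measurable (gauss I)"
    unfolding F_def using p
    by (intro measurable_compose[OF _ measurable_ennreal] borel_measurable_power borel_measurable_diff
        borel_measurable_proj_stat borel_measurable_times borel_measurable_const comp) (auto simp: I_def)
  have T: "preserves (gauss I) T"
    unfolding T_def I_def using p cd by (intro preserves_givens_columns) (auto simp: add.commute)
  have [measurable]: "T \<in> gauss I \<rightarrow>\<^sub>M gauss I" using T by (simp add: preserves_def)
  have fold: "(\<integral>\<^sup>+g. f g \<partial>gauss I) = (\<integral>\<^sup>+w. \<integral>\<^sup>+z. f (col w z) \<partial>gauss ({..<n} \<times> {..<p}) \<partial>gauss {..<n})"
    if "f \<in> borel_measurable (gauss I)" for f
    using that unfolding I_def col_def by (intro nn_integral_gauss_column) auto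
  have FT: "F (T (col v z)) = ennreal ((proj_stat n {..<p} v
      (\<lambda>i j. if j = 0 then c * v i + d * z (i, j) else z (i, j)) - c\<^sup>2)\<^sup>2)" for v z
  proof -
    have "c * (d * z (i, 0) + c * v i) - d * (c * z (i, 0) - d * v i) = v i" for i
    proof -
      have "c * (d * z (i, 0) + c * v i) - d * (c * z (i, 0) - d * v i) = (c\<^sup>2 + d\<^sup>2) * v i"
        by (simp add: power2_eq_square algebra_simps)
      then show ?thesis by (simp add: cd)
    qed
    then show ?thesis
      unfolding F_def using p
      by (intro arg_cong[where f=ennreal] arg_cong[where f="\<lambda>x. x\<^sup>2"] arg_cong2[where f=minus] refl proj_stat_cong)
        (auto simp: T_def col_def I_def givens_def)
  qed
  interpret P: prob_space "gauss {..<n}" by (intro prob_space_PiM) unfold_locales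
  have compn [measurable]: "(\<lambda>g. g i) \<in> borel_measurable (gauss {..<n})" if "i < n" for i
    using that measurable_component_singleton[of i "{..<n}" "\<lambda>_. std_normal_distribution"] by simp
  have chi: "(\<integral>\<^sup>+v. ennreal ((\<Sum>i<n. (v i)\<^sup>2 - 1)\<^sup>2) \<partial>gauss {..<n}) = ennreal (2 * real n)"
    using nn_integral_PiM_square_sum[OF std_normal.prob_space_axioms, of "{..<n}" "\<lambda>_ x. x\<^sup>2 - 1" 0]
      std_normal_quadratic[of 1 0] by simp
  \<comment> \<open>The second moment of one coordinate is read off from the sum formula by taking
    all other summands to be zero.\<close>
  have sq: "(\<integral>\<^sup>+v. ennreal ((v i)\<^sup>2) \<partial>gauss {..<n}) = 1" if i: "i < n" for i
  proof -
    have "(\<Sum>j<n. if j = i then v j else 0) = v i" for v :: "nat \<Rightarrow> real" using i by simp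
    moreover have "(\<Sum>j<n. \<integral>x. (if j = i then x else 0)\<^sup>2 \<partial>std_normal_distribution) = 1"
      using i by (subst sum.remove[of _ i]) (auto simp: std_normal_moments intro!: sum.neutral)
    moreover have "integrable std_normal_distribution (\<lambda>x. if j = i then x else 0)"
      "(\<integral>x. (if j = i then x else 0) \<partial>std_normal_distribution) = 0"
      "integrable std_normal_distribution (\<lambda>x. (if j = i then x else 0)\<^sup>2)" for j
      using std_normal_moments(1)[of 1] std_normal_moments(1)[of 2] std_normal_moments(2) by (cases "j = i"; simp)+
    ultimately show ?thesis
      using nn_integral_PiM_square_sum[OF std_normal.prob_space_axioms, of "{..<n}" "\<lambda>j x. if j = i then x else 0" 0]
      by simp
  qed
  have "(\<integral>\<^sup>+w. \<integral>\<^sup>+z. ennreal ((proj_stat n {..<p} (\<lambda>i. c * z (i, 0) - d * w i) (\<lambda>i j. z (i, j)) - c\<^sup>2)\<^sup>2)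
            \<partial>gauss ({..<n} \<times> {..<p}) \<partial>gauss {..<n})
      = (\<integral>\<^sup>+w. \<integral>\<^sup>+z. F (col w z) \<partial>gauss ({..<n} \<times> {..<p}) \<partial>gauss {..<n})"
    unfolding F_def using p
    by (intro nn_integral_cong arg_cong[where f=ennreal] arg_cong[where f="\<lambda>x. x\<^sup>2"] arg_cong2[where f=minus] refl proj_stat_cong)
        (auto simp: col_def I_def)
  also have "\<dots> = (\<integral>\<^sup>+g. F g \<partial>gauss I)" by (rule fold[symmetric]) measurable
  also have "\<dots> = (\<integral>\<^sup>+g. F (T g) \<partial>gauss I)" by (rule preserves_nn_integral[OF T, symmetric]) measurable
  also have "\<dots> = (\<integral>\<^sup>+v. \<integral>\<^sup>+z. F (T (col v z)) \<partial>gauss ({..<n} \<times> {..<p}) \<partial>gauss {..<n})"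
    by (rule fold) measurable
  also have "\<dots> \<le> (\<integral>\<^sup>+v. ennreal ((2 * (\<Sum>i<n. (v i)\<^sup>2 - 1)\<^sup>2 + (\<Sum>i<n. (v i)\<^sup>2) + (8 + 2 * real (card {..<p}))) / (real n + 1)\<^sup>2) \<partial>gauss {..<n})"
    unfolding FT using n p cd
    by (intro nn_integral_mono order_trans[OF nn_integral_proj_stat_given_response]) (auto intro: order_refl)
  also have "\<dots> = (\<integral>\<^sup>+v. ennreal (1 / (real n + 1)\<^sup>2) * (2 * ennreal ((\<Sum>i<n. (v i)\<^sup>2 - 1)\<^sup>2)
      + (\<Sum>i<n. ennreal ((v i)\<^sup>2)) + ennreal (8 + 2 * real p)) \<partial>gauss {..<n})"
    by (intro nn_integral_cong) (simp add: ennreal_mult[symmetric] ennreal_plus[symmetric] sum_nonneg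
        ennreal_numeral[symmetric] del: ennreal_plus ennreal_numeral)
  also have "\<dots> = ennreal (1 / (real n + 1)\<^sup>2) * (2 * ennreal (2 * real n) + of_nat n + ennreal (8 + 2 * real p))"
  proof -
    have "(\<integral>\<^sup>+v. (\<Sum>i<n. ennreal ((v i)\<^sup>2)) \<partial>gauss {..<n}) = of_nat n"
      by (subst nn_integral_sum) (auto simp: sq)
    then show ?thesis
      by (subst nn_integral_cmult) (auto simp: nn_integral_add nn_integral_cmult chi P.emeasure_space_1)
  qed
  also have "\<dots> = ennreal ((5 * real n + 8 + 2 * real p) / (real n + 1)\<^sup>2)"
    by (simp add: ennreal_mult[symmetric] ennreal_plus[symmetric] ennreal_of_nat_eq_real_of_nat
        ennreal_numeral[symmetric] del: ennreal_plus ennreal_numeral)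
  \<comment> \<open>Since \<open>n \<le> p\<close> and \<open>1 \<le> p\<close>, the numerator is at
    most \<open>(5 + 8 + 2) * p\<close>; the denominator only shrinks from \<open>(n + 1)^2\<close>
    to \<open>n^2\<close>.\<close>
  also have "\<dots> \<le> ennreal (15 * real p / (real n)\<^sup>2)"
    using n np by (intro ennreal_leI frac_le power_mono) auto
  finally show ?thesis .
qed

section \<open>Reduction of the model to a whitened design\<close>

definition normal_map :: "nat \<Rightarrow> real mat \<Rightarrow> (nat \<Rightarrow> real) \<Rightarrow> nat \<Rightarrow> real" where
  "normal_map d A z = (\<lambda>i\<in>{..<d}. (A *\<^sub>v vec d z) $ i)"

lemma centred_normal_iff:
  "centred_normal d S N \<longleftrightarrow> (\<exists>A\<in>carrier_mat d d. A * transpose_mat A = S \<and>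
     N = distr (gauss {..<d}) (coord_space d) (normal_map d A))"
  by (simp add: centred_normal_def std_normal_vec_def normal_map_def[abs_def])

lemma mult_mat_vec_entry:
  assumes "A \<in> carrier_mat d d" "i < d"
  shows "(A *\<^sub>v vec d z) $ i = (\<Sum>j<d. A $$ (i, j) * z j)"
  using assms by (auto simp: scalar_prod_def lessThan_atLeast0 intro!: sum.cong)

lemma measurable_normal_map:
  assumes "A \<in> carrier_mat d d"
  shows "normal_map d A \<in> gauss {..<d} \<rightarrow>\<^sub>M coord_space d"
  unfolding normal_map_def[abs_def]
proof (rule measurable_restrict)
  fix i assume "i \<in> {..<d}"
  then have "(\<lambda>z. (A *\<^sub>v vec d z) $ i) = (\<lambda>z. \<Sum>j<d. A $$ (i, j) * z j)"
    by (intro ext mult_mat_vec_entry assms) simp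
  also have "\<dots> \<in> borel_measurable (gauss {..<d})"
    using measurable_component_singleton[of _ "{..<d}" "\<lambda>_. std_normal_distribution"]
    by (intro borel_measurable_sum borel_measurable_times) auto
  finally show "(\<lambda>z. (A *\<^sub>v vec d z) $ i) \<in> borel_measurable (gauss {..<d})" .
qed

lemma normal_map_mult:
  assumes "A \<in> carrier_mat d d" "B \<in> carrier_mat d d"
  shows "normal_map d (A * B) z = normal_map d A (normal_map d B z)"
proof -
  have "vec d (normal_map d B z) = B *\<^sub>v vec d z"
    using assms by (intro eq_vecI) (auto simp: normal_map_def)
  then show ?thesis using assms by (simp add: normal_map_def)
qed

lemma preserves_normal_map:
  assumes Q: "Q \<in> carrier_mat d d" "Q * transpose_mat Q = 1\<^sub>m d"
  shows "preserves (gauss {..<d}) (normal_map d Q)"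
proof -
  \<comment> \<open>The hypothesis makes the rows of Q orthonormal, whereas
    \<open>preserves_lin_comb\<close> asks for orthonormal columns; for a square matrix a right
    inverse is also a left inverse.\<close>
  have QT: "transpose_mat Q * Q = 1\<^sub>m d"
    using mat_mult_left_right_inverse[of Q d "transpose_mat Q"] Q by simp
  have "(\<Sum>i<d. Q $$ (i, k) * Q $$ (i, l)) = (if k = l then 1 else 0)" if "k < d" "l < d" for k l
  proof -
    have "(\<Sum>i<d. Q $$ (i, k) * Q $$ (i, l)) = (transpose_mat Q * Q) $$ (k, l)"
      using Q that by (simp add: scalar_prod_def lessThan_atLeast0)
    then show ?thesis using that by (simp add: QT)
  qed
  then have "orthonormal {..<d} (\<lambda>k i. Q $$ (i, k))" by (simp add: orthonormal_def)
  from preserves_lin_comb[OF _ this] have "preserves (gauss {..<d}) (lin_comb {..<d} (\<lambda>k i. Q $$ (i, k)))" by simp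
  moreover have "normal_map d Q = lin_comb {..<d} (\<lambda>k i. Q $$ (i, k))"
    using Q by (auto simp: fun_eq_iff normal_map_def lin_comb_def mult_mat_vec_entry mult.commute simp del: index_mult_mat_vec)
  ultimately show ?thesis by simp
qed

text \<open>Multiplying the square root on the right by an orthogonal matrix only rotates the
  standard normal vector. This freedom is used to normalise the witnesses hidden in
  \<open>centred_normal\<close>.\<close>

lemma distr_normal_map_mult:
  assumes A: "A \<in> carrier_mat d d" and Q: "Q \<in> carrier_mat d d" "Q * transpose_mat Q = 1\<^sub>m d"
  shows "distr (gauss {..<d}) (coord_space d) (normal_map d (A * Q))
       = distr (gauss {..<d}) (coord_space d) (normal_map d A)"
proof -
  have P: "normal_map d Q \<in> gauss {..<d} \<rightarrow>\<^sub>M gauss {..<d}"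
      "distr (gauss {..<d}) (gauss {..<d}) (normal_map d Q) = gauss {..<d}"
    using preserves_normal_map[OF Q] by (auto simp: preserves_def)
  have "distr (gauss {..<d}) (coord_space d) (normal_map d A)
      = distr (distr (gauss {..<d}) (gauss {..<d}) (normal_map d Q)) (coord_space d) (normal_map d A)"
    by (simp add: P)
  also have "\<dots> = distr (gauss {..<d}) (coord_space d) (normal_map d A \<circ> normal_map d Q)"
    by (rule distr_distr[OF measurable_normal_map[OF A] P(1)])
  also have "normal_map d A \<circ> normal_map d Q = normal_map d (A * Q)"
    by (simp add: fun_eq_iff normal_map_mult[OF A Q(1)])
  finally show ?thesis by simp
qed

definition reflect_mat :: "nat \<Rightarrow> (nat \<Rightarrow> real) \<Rightarrow> real mat" where
  "reflect_mat d u = mat d d (\<lambda>(i, j). reflect {..<d} u (\<lambda>k. if k = j then 1 else 0) i)"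

lemma reflect_mat:
  shows "reflect_mat d u \<in> carrier_mat d d"
    and "transpose_mat (reflect_mat d u) = reflect_mat d u"
    and "reflect_mat d u *\<^sub>v vec d z = vec d (reflect {..<d} u z)"
    and "reflect_mat d u * reflect_mat d u = 1\<^sub>m d"
proof -
  have e: "reflect {..<d} u (\<lambda>k. if k = j then 1 else 0) i
      = (if i = j then 1 else 0) - 2 * u j / (\<Sum>k<d. (u k)\<^sup>2) * u i" if "i < d" "j < d" for i j
    using that by (simp add: reflect_apply if_distrib[of "\<lambda>x. _ * x"] cong: if_cong)
  show C: "reflect_mat d u \<in> carrier_mat d d" by (simp add: reflect_mat_def)
  show S: "transpose_mat (reflect_mat d u) = reflect_mat d u"
    by (rule eq_matI) (auto simp: reflect_mat_def e)
  show V: "reflect_mat d u *\<^sub>v vec d z = vec d (reflect {..<d} u z)" for z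
  proof (rule eq_vecI)
    fix i assume "i < dim_vec (vec d (reflect {..<d} u z))"
    then have i: "i < d" by simp
    have "reflect {..<d} u z = reflect {..<d} u (\<lambda>i. \<Sum>k<d. z k * (if i = k then 1 else 0))"
      by (intro reflect_cong) (simp add: if_distrib[of "\<lambda>x. _ * x"] cong: if_cong)
    then have "reflect {..<d} u z i = (\<Sum>k<d. z k * reflect {..<d} u (\<lambda>i. if i = k then 1 else 0) i)"
      using i reflect_sum[of "{..<d}" i u z "\<lambda>k i. if i = k then 1 else 0" "{..<d}"] by simp
    then show "(reflect_mat d u *\<^sub>v vec d z) $ i = vec d (reflect {..<d} u z) $ i"
      unfolding mult_mat_vec_entry[OF C i] using i by (simp add: reflect_mat_def mult.commute)
  qed (simp add: reflect_mat_def)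
  show "reflect_mat d u * reflect_mat d u = 1\<^sub>m d"
  proof (rule eq_matI)
    fix i j assume ij: "i < dim_row (1\<^sub>m d :: real mat)" "j < dim_col (1\<^sub>m d :: real mat)"
    have "(reflect_mat d u * reflect_mat d u) $$ (i, j) = (reflect_mat d u *\<^sub>v col (reflect_mat d u) j) $ i"
      using ij C by simp
    also have "col (reflect_mat d u) j = vec d (reflect {..<d} u (\<lambda>k. if k = j then 1 else 0))"
      using ij by (intro eq_vecI) (auto simp: reflect_mat_def)
    finally show "(reflect_mat d u * reflect_mat d u) $$ (i, j) = 1\<^sub>m d $$ (i, j)"
      using ij by (simp add: V reflect_reflect)
  qed (simp_all add: reflect_mat_def)
qed

text \<open>A square root A of the covariance may be replaced by \<open>A * H\<close> with H a
  reflection. Taking the H that sends \<open>transpose_mat A *\<^sub>v \<beta>\<close> to a multiple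
  of the first basis vector makes the signal depend on the first whitened column alone; s is the
  norm of that vector, so its square is the signal variance.\<close>

lemma centred_normal_aligned:
  assumes N: "centred_normal p S N" and \<beta>: "\<beta> \<in> carrier_vec p" and p: "0 < p"
  obtains A s where "A \<in> carrier_mat p p" "A * transpose_mat A = S"
    "N = distr (gauss {..<p}) (coord_space p) (normal_map p A)"
    "transpose_mat A *\<^sub>v \<beta> = vec p (\<lambda>i. if i = 0 then s else 0)"
proof -
  obtain A where A: "A \<in> carrier_mat p p" "A * transpose_mat A = S"
      "N = distr (gauss {..<p}) (coord_space p) (normal_map p A)"
    using N unfolding centred_normal_iff by auto
  define b where "b i = (transpose_mat A *\<^sub>v \<beta>) $ i" for i
  have b: "transpose_mat A *\<^sub>v \<beta> = vec p b" using A by (intro eq_vecI) (auto simp: b_def)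
  define s where "s = sqrt (\<Sum>i<p. (b i)\<^sup>2)"
  define H where "H = reflect_mat p (\<lambda>i. b i - (if i = 0 then s else 0))"
  note HR = reflect_mat[of p "\<lambda>i. b i - (if i = 0 then s else 0)", folded H_def]
  have "(\<Sum>i<p. (if i = 0 then s else 0)\<^sup>2) = s\<^sup>2"
    using p by (subst sum.remove[of _ 0]) (auto intro!: sum.neutral)
  then have s: "(\<Sum>i<p. (b i)\<^sup>2) = (\<Sum>i<p. (if i = 0 then s else 0)\<^sup>2)"
    by (simp add: s_def sum_nonneg)
  show thesis
  proof (rule that)
    show "A * H \<in> carrier_mat p p" using A HR by simp
    have "A * H * transpose_mat (A * H) = A * H * (H * transpose_mat A)"
      using A HR by (simp add: transpose_mult)
    also have "\<dots> = A * (H * H) * transpose_mat A"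
      using A HR(1) by (simp add: assoc_mult_mat[of _ p p _ p _ p])
    finally show "A * H * transpose_mat (A * H) = S" using A HR by simp
    show "N = distr (gauss {..<p}) (coord_space p) (normal_map p (A * H))"
      using A HR by (subst distr_normal_map_mult) auto
    have "transpose_mat (A * H) *\<^sub>v \<beta> = H *\<^sub>v (transpose_mat A *\<^sub>v \<beta>)"
      using A HR \<beta> by (simp add: transpose_mult assoc_mult_mat_vec[of _ p p _ p])
    also have "\<dots> = vec p (\<lambda>i. if i = 0 then s else 0)"
      unfolding b HR(3) using s by (intro eq_vecI) (auto simp: reflect_exchange)
    finally show "transpose_mat (A * H) *\<^sub>v \<beta> = vec p (\<lambda>i. if i = 0 then s else 0)" .
  qed
qed

text \<open>The sign is immaterial to the law; the negative one makes the pair of signal and noise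
  directions the image of a reflection, so that no separate rotation is needed.\<close>

lemma centred_normal_isotropic:
  assumes E: "centred_normal n (\<sigma>\<^sup>2 \<cdot>\<^sub>m 1\<^sub>m n) E" and \<sigma>: "0 < \<sigma>"
  shows "E = distr (gauss {..<n}) (coord_space n) (\<lambda>w. \<lambda>i\<in>{..<n}. - \<sigma> * w i)"
proof -
  obtain B where B: "B \<in> carrier_mat n n" "B * transpose_mat B = \<sigma>\<^sup>2 \<cdot>\<^sub>m 1\<^sub>m n"
      "E = distr (gauss {..<n}) (coord_space n) (normal_map n B)"
    using E unfolding centred_normal_iff by auto
  \<comment> \<open>By the equation for B, the matrix \<open>- B / \<sigma>\<close> is orthogonal,
    so B differs from \<open>- \<sigma>\<close> times the identity by an orthogonal factor on the
    right.\<close>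
  define Q where "Q = (- 1 / \<sigma>) \<cdot>\<^sub>m B"
  have Q: "Q \<in> carrier_mat n n" using B by (simp add: Q_def)
  have "transpose_mat Q = (- 1 / \<sigma>) \<cdot>\<^sub>m transpose_mat B" by (rule eq_matI) (auto simp: Q_def)
  then have "Q * transpose_mat Q = (- 1 / \<sigma>) \<cdot>\<^sub>m ((- 1 / \<sigma>) \<cdot>\<^sub>m (B * transpose_mat B))"
    using B by (simp add: Q_def mult_smult_assoc_mat[of _ n n _ n] mult_smult_distrib[of _ n n _ n])
  also have "\<dots> = 1\<^sub>m n"
    unfolding B(2) using \<sigma> by (intro eq_matI) (auto simp: power2_eq_square)
  finally have QQ: "Q * transpose_mat Q = 1\<^sub>m n" .
  define D :: "real mat" where "D = (- \<sigma>) \<cdot>\<^sub>m 1\<^sub>m n"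
  have D: "D \<in> carrier_mat n n" by (simp add: D_def)
  have "B = D * Q"
    using B \<sigma> by (intro eq_matI) (auto simp: D_def Q_def mult_smult_assoc_mat[of _ n n _ n])
  then have "E = distr (gauss {..<n}) (coord_space n) (normal_map n D)"
    using B(3) distr_normal_map_mult[OF D Q QQ] by simp
  moreover have "normal_map n D = (\<lambda>w. \<lambda>i\<in>{..<n}. - \<sigma> * w i)"
  proof (intro ext)
    fix w i
    have "(\<Sum>j<n. D $$ (i, j) * w j) = - \<sigma> * w i" if "i < n"
      using that by (subst sum.remove[of _ i]) (auto simp: D_def intro!: sum.neutral)
    then show "normal_map n D w i = (\<lambda>i\<in>{..<n}. - \<sigma> * w i) i"
      using D by (simp add: normal_map_def mult_mat_vec_entry del: index_mult_mat_vec)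
  qed
  ultimately show ?thesis by simp
qed

section \<open>The estimator in coordinates: measurability and whitening\<close>

lemma eta_hat_entries:
  assumes X: "X \<in> carrier_mat n p" and \<Omega>: "\<Omega> \<in> carrier_mat p p" and Y: "Y \<in> carrier_vec n"
  defines "G \<equiv> X * \<Omega> * transpose_mat X"
  shows "eta_hat n \<Omega> X Y = ((\<Sum>i<n. \<Sum>k<n. Y $ i * G $$ (i, k) * Y $ k) - (\<Sum>i<n. G $$ (i, i)) / real n * (\<Sum>i<n. (Y $ i)\<^sup>2))
     / ((real n + 1) * (\<Sum>i<n. (Y $ i)\<^sup>2))"
proof -
  have G: "G \<in> carrier_mat n n" using X \<Omega> by (simp add: G_def)
  define t where "t = (\<Sum>i<n. G $$ (i, i)) / real n"
  have tr: "mat_trace G / real n = t" using G by (simp add: mat_trace_def t_def)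
  have YY: "Y \<bullet> Y = (\<Sum>i<n. (Y $ i)\<^sup>2)"
    using Y by (simp add: scalar_prod_def lessThan_atLeast0 power2_eq_square)
  have "Y \<bullet> ((G - t \<cdot>\<^sub>m 1\<^sub>m n) *\<^sub>v Y) = (\<Sum>i<n. Y $ i * (\<Sum>k<n. (G $$ (i, k) - t * (if i = k then 1 else 0)) * Y $ k))"
    using G Y by (simp add: scalar_prod_def lessThan_atLeast0)
  also have "\<dots> = (\<Sum>i<n. \<Sum>k<n. Y $ i * G $$ (i, k) * Y $ k) - t * (\<Sum>i<n. (Y $ i)\<^sup>2)"
    by (simp add: left_diff_distrib right_diff_distrib sum_subtractf sum_distrib_left if_distrib[of "\<lambda>x. _ * x"]
        if_distribR power2_eq_square ac_simps cong: if_cong)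
  finally show ?thesis
    by (simp add: eta_hat_def Let_def G_def[symmetric] tr YY t_def)
qed

text \<open>The vector and matrix types carry no sigma-algebra, so the matrix expression is first
  rewritten as an explicit rational function of the real coordinates of the outcome.\<close>

lemma borel_measurable_squared_error:
  assumes \<Omega>: "\<Omega> \<in> carrier_mat p p" and \<beta>: "\<beta> \<in> carrier_vec p"
    and x: "\<And>i j. i < n \<Longrightarrow> j < p \<Longrightarrow> (\<lambda>\<omega>. fst \<omega> i j) \<in> borel_measurable M"
    and e: "\<And>i. i < n \<Longrightarrow> (\<lambda>\<omega>. snd \<omega> i) \<in> borel_measurable M"
  shows "squared_error n p \<Sigma> \<Omega> \<beta> \<sigma> \<in> borel_measurable M"
proof -
  define y where "y \<omega> i = (\<Sum>j<p. fst \<omega> i j * \<beta> $ j) + snd \<omega> i" for \<omega> :: "(nat \<Rightarrow> nat \<Rightarrow> real) \<times> (nat \<Rightarrow> real)" and i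
  define G where "G \<omega> i k = (\<Sum>l<p. (\<Sum>j<p. fst \<omega> i j * \<Omega> $$ (j, l)) * fst \<omega> k l)" for \<omega> :: "(nat \<Rightarrow> nat \<Rightarrow> real) \<times> (nat \<Rightarrow> real)" and i k
  have y: "(\<lambda>\<omega>. y \<omega> i) \<in> borel_measurable M" if "i < n" for i
    unfolding y_def using that
    by (intro borel_measurable_add borel_measurable_sum borel_measurable_times borel_measurable_const x e) auto
  have G: "(\<lambda>\<omega>. G \<omega> i k) \<in> borel_measurable M" if "i < n" "k < n" for i k
    unfolding G_def using that
    by (intro borel_measurable_add borel_measurable_sum borel_measurable_times borel_measurable_const x) auto
  have "squared_error n p \<Sigma> \<Omega> \<beta> \<sigma> \<omega> = (((\<Sum>i<n. \<Sum>k<n. y \<omega> i * G \<omega> i k * y \<omega> k)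
      - (\<Sum>i<n. G \<omega> i i) / real n * (\<Sum>i<n. (y \<omega> i)\<^sup>2)) / ((real n + 1) * (\<Sum>i<n. (y \<omega> i)\<^sup>2))
      - explained_variation \<Sigma> \<beta> \<sigma>)\<^sup>2" for \<omega>
  proof -
    define X where "X = design_mat n p (fst \<omega>)"
    define Y where "Y = response X \<beta> (vec n (snd \<omega>))"
    have X: "X \<in> carrier_mat n p" by (simp add: X_def design_mat_def)
    have Y: "Y \<in> carrier_vec n" unfolding Y_def response_def by (rule carrier_vecI) simp
    have Yi: "Y $ i = y \<omega> i" if "i < n" for i
      using that \<beta> by (simp add: Y_def X_def response_def design_mat_def y_def scalar_prod_def lessThan_atLeast0)
    have Gi: "(X * \<Omega> * transpose_mat X) $$ (i, k) = G \<omega> i k" if "i < n" "k < n" for i k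
      using that \<Omega> by (simp add: X_def design_mat_def G_def scalar_prod_def lessThan_atLeast0)
    have "squared_error n p \<Sigma> \<Omega> \<beta> \<sigma> \<omega> = (eta_hat n \<Omega> X Y - explained_variation \<Sigma> \<beta> \<sigma>)\<^sup>2"
      by (simp add: squared_error_def split_beta' Let_def X_def Y_def)
    then show ?thesis by (simp add: eta_hat_entries[OF X \<Omega> Y] Yi Gi)
  qed
  then have "squared_error n p \<Sigma> \<Omega> \<beta> \<sigma> = (\<lambda>\<omega>. (((\<Sum>i<n. \<Sum>k<n. y \<omega> i * G \<omega> i k * y \<omega> k)
      - (\<Sum>i<n. G \<omega> i i) / real n * (\<Sum>i<n. (y \<omega> i)\<^sup>2)) / ((real n + 1) * (\<Sum>i<n. (y \<omega> i)\<^sup>2))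
      - explained_variation \<Sigma> \<beta> \<sigma>)\<^sup>2)" by (intro ext)
  also have "\<dots> \<in> borel_measurable M"
    by (intro borel_measurable_power borel_measurable_diff borel_measurable_divide borel_measurable_times
        borel_measurable_sum borel_measurable_const y G) auto
  finally show ?thesis .
qed

text \<open>With design \<open>X = Z * transpose_mat A\<close> the signal is s times the first
  column of Z, and each entry of the response has variance \<open>s^2 + \<sigma>^2\<close>. Dividing
  by its root \<open>\<tau>\<close> leaves the estimator unchanged and turns the explained variation
  into \<open>(s / \<tau>)^2\<close>.\<close>

lemma squared_error_whitened:
  assumes n: "1 \<le> n" and A: "A \<in> carrier_mat p p" "A * transpose_mat A = \<Sigma>"
    and \<Omega>: "\<Omega> \<in> carrier_mat p p" "inverts_mat \<Sigma> \<Omega>" and \<beta>: "\<beta> \<in> carrier_vec p"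
    and s: "transpose_mat A *\<^sub>v \<beta> = vec p (\<lambda>i. if i = 0 then s else 0)" and p: "0 < p" and \<sigma>: "0 < \<sigma>"
  defines "\<tau> \<equiv> sqrt (s\<^sup>2 + \<sigma>\<^sup>2)"
  shows "squared_error n p \<Sigma> \<Omega> \<beta> \<sigma>
      (\<lambda>i\<in>{..<n}. normal_map p A (\<lambda>j\<in>{..<p}. z (i, j)), \<lambda>i\<in>{..<n}. - \<sigma> * w i)
    = (proj_stat n {..<p} (\<lambda>i. s / \<tau> * z (i, 0) - \<sigma> / \<tau> * w i) (\<lambda>i j. z (i, j)) - (s / \<tau>)\<^sup>2)\<^sup>2"
    (is "squared_error _ _ _ _ _ _ (?x, ?e) = _")
proof -
  have \<tau>2: "\<tau>\<^sup>2 = s\<^sup>2 + \<sigma>\<^sup>2" by (simp add: \<tau>_def)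
  have \<tau>: "\<tau> \<noteq> 0" using \<sigma> by (simp add: \<tau>_def)
  define Z where "Z = mat n p z"
  have Z: "Z \<in> carrier_mat n p" by (simp add: Z_def)
  define X where "X = design_mat n p ?x"
  have XZ: "X = Z * transpose_mat A"
  proof (rule eq_matI)
    fix i k assume "i < dim_row (Z * transpose_mat A)" "k < dim_col (Z * transpose_mat A)"
    then have ik: "i < n" "k < p" using Z A by auto
    have "X $$ (i, k) = (\<Sum>j<p. A $$ (k, j) * z (i, j))"
      using ik A by (simp add: X_def design_mat_def normal_map_def mult_mat_vec_entry del: index_mult_mat_vec)
    also have "\<dots> = (Z * transpose_mat A) $$ (i, k)"
      using ik A Z by (simp add: Z_def scalar_prod_def lessThan_atLeast0 mult.commute)
    finally show "X $$ (i, k) = (Z * transpose_mat A) $$ (i, k)" .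
  qed (use Z A in \<open>auto simp: X_def design_mat_def\<close>)
  have X: "X \<in> carrier_mat n p" by (simp add: X_def design_mat_def)
  have AT: "transpose_mat A \<in> carrier_mat p p" using A by simp
  have "dim_row \<Sigma> = p" using A by auto
  \<comment> \<open>\<open>transpose_mat A * \<Omega>\<close> is a right inverse of the square
    matrix A, hence also a left inverse; this is the identity that cancels the covariance inside
    \<open>X * \<Omega> * transpose_mat X\<close>.\<close>
  then have "A * (transpose_mat A * \<Omega>) = 1\<^sub>m p"
    using A \<Omega> AT by (simp add: inverts_mat_def assoc_mult_mat[of _ p p _ p _ p, symmetric])
  then have AA: "transpose_mat A * \<Omega> * A = 1\<^sub>m p"
    using A \<Omega> AT by (intro mat_mult_left_right_inverse[of A p]) auto
  have XX: "X * \<Omega> * transpose_mat X = Z * transpose_mat Z"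
  proof -
    have "X * \<Omega> * transpose_mat X = Z * transpose_mat A * \<Omega> * (A * transpose_mat Z)"
      unfolding XZ using Z A AT by (simp add: transpose_mult)
    also have "\<dots> = Z * (transpose_mat A * \<Omega>) * (A * transpose_mat Z)"
      using Z AT \<Omega> by (simp add: assoc_mult_mat[of _ n p _ p _ p])
    also have "\<dots> = Z * (transpose_mat A * \<Omega> * (A * transpose_mat Z))"
      using Z A AT \<Omega> by (intro assoc_mult_mat[of _ n p _ p _ n]) auto
    also have "transpose_mat A * \<Omega> * (A * transpose_mat Z) = transpose_mat A * \<Omega> * A * transpose_mat Z"
      using Z A AT \<Omega> by (intro assoc_mult_mat[of _ p p _ p _ n, symmetric]) auto
    also have "\<dots> = transpose_mat Z" using Z by (simp add: AA)
    finally show ?thesis .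
  qed
  define Y where "Y = response X \<beta> (vec n ?e)"
  have Y: "Y \<in> carrier_vec n" unfolding Y_def response_def by (rule carrier_vecI) simp
  define v where "v i = s / \<tau> * z (i, 0) - \<sigma> / \<tau> * w i" for i
  have Yi: "Y $ i = \<tau> * v i" if i: "i < n" for i
  proof -
    have "X *\<^sub>v \<beta> = Z *\<^sub>v vec p (\<lambda>i. if i = 0 then s else 0)"
      unfolding XZ s[symmetric] using Z AT \<beta> by simp
    then have "(X *\<^sub>v \<beta>) $ i = (\<Sum>j<p. z (i, j) * (if j = 0 then s else 0))"
      using i Z by (simp add: Z_def scalar_prod_def lessThan_atLeast0)
    also have "\<dots> = s * z (i, 0)"
      using p by (subst sum.remove[of _ 0]) (auto intro!: sum.neutral)
    finally have "Y $ i = s * z (i, 0) - \<sigma> * w i" using i by (simp add: Y_def response_def del: index_mult_mat_vec)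
    then show ?thesis using \<tau> by (simp add: v_def right_diff_distrib)
  qed
  have G: "(Z * transpose_mat Z) $$ (i, k) = (\<Sum>j<p. z (i, j) * z (k, j))" if "i < n" "k < n" for i k
    using that by (simp add: Z_def scalar_prod_def lessThan_atLeast0)
  have "eta_hat n \<Omega> X Y = proj_stat n {..<p} (\<lambda>i. \<tau> * v i) (\<lambda>i j. z (i, j))"
  proof -
    have 1: "(\<Sum>i<n. \<Sum>k<n. Y $ i * (Z * transpose_mat Z) $$ (i, k) * Y $ k)
        = (\<Sum>j<p. (\<Sum>i<n. \<tau> * v i * z (i, j))\<^sup>2)"
    proof -
      have "(\<Sum>i<n. \<Sum>k<n. Y $ i * (Z * transpose_mat Z) $$ (i, k) * Y $ k)
          = (\<Sum>i<n. \<Sum>k<n. \<Sum>j<p. (\<tau> * v i * z (i, j)) * (\<tau> * v k * z (k, j)))"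
        by (intro sum.cong refl) (simp add: Yi G sum_distrib_left sum_distrib_right ac_simps)
      also have "\<dots> = (\<Sum>j<p. \<Sum>i<n. \<Sum>k<n. (\<tau> * v i * z (i, j)) * (\<tau> * v k * z (k, j)))"
        by (simp only: sum.swap[of _ "{..<p}" "{..<n}"])
      finally show ?thesis by (simp only: power2_eq_square sum_product)
    qed
    have 2: "(\<Sum>i<n. (Z * transpose_mat Z) $$ (i, i)) = (\<Sum>j<p. \<Sum>i<n. (z (i, j))\<^sup>2)"
      by (subst sum.swap) (simp add: G power2_eq_square)
    show ?thesis
      unfolding eta_hat_entries[OF X \<Omega>(1) Y] XX 1 2 proj_stat_def by (simp add: Yi)
  qed
  also have "\<dots> = proj_stat n {..<p} v (\<lambda>i j. z (i, j))" by (rule proj_stat_scale[OF \<tau>])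
  finally have eta: "eta_hat n \<Omega> X Y = proj_stat n {..<p} v (\<lambda>i j. z (i, j))" .
  have "\<beta> \<bullet> (\<Sigma> *\<^sub>v \<beta>) = (transpose_mat A *\<^sub>v \<beta>) \<bullet> (transpose_mat A *\<^sub>v \<beta>)"
    using A AT \<beta> by (simp add: A(2)[symmetric] assoc_mult_mat_vec[of _ p p _ p] transpose_vec_mult_scalar[of A p p] comm_scalar_prod[of \<beta> p])
  also have "\<dots> = (\<Sum>i<p. (if i = 0 then s else 0) * (if i = 0 then s else 0))"
    by (simp add: s scalar_prod_def lessThan_atLeast0)
  also have "\<dots> = s\<^sup>2"
    using p by (subst sum.remove[of _ 0]) (auto simp: power2_eq_square intro!: sum.neutral)
  finally have "explained_variation \<Sigma> \<beta> \<sigma> = (s / \<tau>)\<^sup>2"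
    by (simp add: explained_variation_def power_divide \<tau>2 add.commute)
  moreover have "squared_error n p \<Sigma> \<Omega> \<beta> \<sigma> (?x, ?e) = (eta_hat n \<Omega> X Y - explained_variation \<Sigma> \<beta> \<sigma>)\<^sup>2"
    by (simp add: squared_error_def Let_def X_def Y_def)
  ultimately show ?thesis by (simp add: eta v_def[abs_def])
qed

text \<open>Pulls the integral back from the model law to standard normal coordinates. The noise is
  made the outer variable, although it is the second factor of the product, to match the form in
  which the noise column is split from the array.\<close>

lemma nn_integral_design_noise_law:
  assumes n: "1 \<le> n" and p: "0 < p" and A: "A \<in> carrier_mat p p"
    and N: "N = distr (gauss {..<p}) (coord_space p) (normal_map p A)"
    and E: "E = distr (gauss {..<n}) (coord_space n) h" and h: "h \<in> gauss {..<n} \<rightarrow>\<^sub>M coord_space n"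
    and f [measurable]: "f \<in> borel_measurable (design_noise_law n N E)"
  shows "(\<integral>\<^sup>+\<omega>. f \<omega> \<partial>design_noise_law n N E)
    = (\<integral>\<^sup>+w. \<integral>\<^sup>+z. f (\<lambda>i\<in>{..<n}. normal_map p A (\<lambda>j\<in>{..<p}. z (i, j)), h w)
        \<partial>gauss ({..<n} \<times> {..<p}) \<partial>gauss {..<n})"
proof -
  interpret gp: prob_space "gauss {..<p}" by (intro prob_space_PiM) unfold_locales
  interpret gn: prob_space "gauss {..<n}" by (intro prob_space_PiM) unfold_locales
  have A' [measurable]: "normal_map p A \<in> gauss {..<p} \<rightarrow>\<^sub>M N"
    using measurable_normal_map[OF A] by (simp add: N)
  \<comment> \<open>\<open>distr\<close> depends on its target only through space and sigma-algebra,
    so the target may be N itself; the product of the row maps then lands in the product of copies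
    of N.\<close>
  have N': "N = distr (gauss {..<p}) N (normal_map p A)"
    unfolding N by (intro distr_cong) auto
  interpret N: prob_space N unfolding N by (intro gp.prob_space_distr measurable_normal_map A)
  interpret E: prob_space E unfolding E by (intro gn.prob_space_distr h)
  interpret PN: prob_space "PiM {..<n} (\<lambda>_. N)" by (intro prob_space_PiM N.prob_space_axioms)
  interpret NE: pair_sigma_finite "PiM {..<n} (\<lambda>_. N)" E by unfold_locales
  have rows: "PiM {..<n} (\<lambda>_. N) = distr (PiM {..<n} (\<lambda>_. gauss {..<p})) (PiM {..<n} (\<lambda>_. N)) (compose {..<n} (normal_map p A))"
  proof -
    have "distr (PiM {..<n} (\<lambda>_. gauss {..<p})) (PiM {..<n} (\<lambda>_. N)) (compose {..<n} (normal_map p A))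
        = PiM {..<n} (\<lambda>_. distr (gauss {..<p}) N (normal_map p A))"
      by (intro distr_PiM_finite_prob_space' A') (auto intro: gp.prob_space_axioms N.prob_space_axioms)
    then show ?thesis using N' by simp
  qed
  define g where "g z = (\<lambda>i\<in>{..<n}. \<lambda>j\<in>{..<p}. z (i, j))" for z :: "nat \<times> nat \<Rightarrow> real"
  have gauss_rows: "PiM {..<n} (\<lambda>_. gauss {..<p}) = distr (gauss ({..<n} \<times> {..<p})) (PiM {..<n} (\<lambda>_. gauss {..<p})) g"
    unfolding g_def[abs_def] using n p by (intro distr_gauss_rows[symmetric]) (auto simp: lessThan_empty_iff)
  have g [measurable]: "g \<in> gauss ({..<n} \<times> {..<p}) \<rightarrow>\<^sub>M PiM {..<n} (\<lambda>_. gauss {..<p})"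
    unfolding g_def[abs_def] by (intro measurable_restrict measurable_component_singleton) auto
  have comp [measurable]: "compose {..<n} (normal_map p A) \<in> PiM {..<n} (\<lambda>_. gauss {..<p}) \<rightarrow>\<^sub>M PiM {..<n} (\<lambda>_. N)"
    unfolding compose_def[abs_def] by measurable
  have h' [measurable]: "h \<in> gauss {..<n} \<rightarrow>\<^sub>M E" using h by (simp add: E)
  have f' [measurable]: "f \<in> borel_measurable (PiM {..<n} (\<lambda>_. N) \<Otimes>\<^sub>M E)"
    using f by (simp add: design_noise_law_def)
  have row_int: "(\<integral>\<^sup>+x. f (x, e) \<partial>PiM {..<n} (\<lambda>_. N))
      = (\<integral>\<^sup>+z. f (\<lambda>i\<in>{..<n}. normal_map p A (\<lambda>j\<in>{..<p}. z (i, j)), e) \<partial>gauss ({..<n} \<times> {..<p}))"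
    if [measurable]: "e \<in> space E" for e
  proof -
    have "(\<integral>\<^sup>+x. f (x, e) \<partial>PiM {..<n} (\<lambda>_. N))
        = (\<integral>\<^sup>+x. f (compose {..<n} (normal_map p A) x, e) \<partial>PiM {..<n} (\<lambda>_. gauss {..<p}))"
      by (subst rows, subst nn_integral_distr) measurable
    also have "\<dots> = (\<integral>\<^sup>+z. f (compose {..<n} (normal_map p A) (g z), e) \<partial>gauss ({..<n} \<times> {..<p}))"
      by (subst gauss_rows, subst nn_integral_distr) measurable
    also have "\<dots> = (\<integral>\<^sup>+z. f (\<lambda>i\<in>{..<n}. normal_map p A (\<lambda>j\<in>{..<p}. z (i, j)), e) \<partial>gauss ({..<n} \<times> {..<p}))"
      by (intro nn_integral_cong arg_cong[where f=f]) (auto simp: compose_def g_def fun_eq_iff)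
    finally show ?thesis .
  qed
  have "(\<integral>\<^sup>+\<omega>. f \<omega> \<partial>design_noise_law n N E) = (\<integral>\<^sup>+e. \<integral>\<^sup>+x. f (x, e) \<partial>PiM {..<n} (\<lambda>_. N) \<partial>E)"
    unfolding design_noise_law_def by (rule NE.nn_integral_snd[symmetric]) measurable
  also have "\<dots> = (\<integral>\<^sup>+e. \<integral>\<^sup>+x. f (x, e) \<partial>PiM {..<n} (\<lambda>_. N) \<partial>distr (gauss {..<n}) E h)"
    unfolding E by (intro arg_cong2[where f=nn_integral] distr_cong refl) simp_all
  also have "\<dots> = (\<integral>\<^sup>+w. \<integral>\<^sup>+x. f (x, h w) \<partial>PiM {..<n} (\<lambda>_. N) \<partial>gauss {..<n})"
    by (subst nn_integral_distr) measurable
  also have "\<dots> = (\<integral>\<^sup>+w. \<integral>\<^sup>+z. f (\<lambda>i\<in>{..<n}. normal_map p A (\<lambda>j\<in>{..<p}. z (i, j)), h w)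
        \<partial>gauss ({..<n} \<times> {..<p}) \<partial>gauss {..<n})"
    using measurable_space[OF h'] by (intro nn_integral_cong row_int)
  finally show ?thesis .
qed

theorem corollary2p2:
  shows "\<exists>C::real. 0 < C \<and>
    (\<forall>(n::nat) (p::nat) (\<Sigma>::real mat) (\<Omega>::real mat) (\<beta>::real vec) (\<sigma>::real)
       (N::(nat \<Rightarrow> real) measure) (E::(nat \<Rightarrow> real) measure).
       1 \<le> n \<longrightarrow> n \<le> p \<longrightarrow>
       covariance_mat p \<Sigma> \<longrightarrow> invertible_mat \<Sigma> \<longrightarrow>
       \<Omega> \<in> carrier_mat p p \<longrightarrow> inverts_mat \<Sigma> \<Omega> \<longrightarrow> inverts_mat \<Omega> \<Sigma> \<longrightarrow>
       \<beta> \<in> carrier_vec p \<longrightarrow> 0 < \<sigma> \<longrightarrow>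
       centred_normal p \<Sigma> N \<longrightarrow> centred_normal n (\<sigma>\<^sup>2 \<cdot>\<^sub>m 1\<^sub>m n) E \<longrightarrow>
       integrable (design_noise_law n N E) (squared_error n p \<Sigma> \<Omega> \<beta> \<sigma>) \<and>
       (\<integral>\<omega>. squared_error n p \<Sigma> \<Omega> \<beta> \<sigma> \<omega> \<partial>(design_noise_law n N E))
         \<le> C * real p / (real n)\<^sup>2)"
proof (intro exI[of _ 15] conjI allI impI)
  show "(0::real) < 15" by simp
  fix n p :: nat and \<Sigma> \<Omega> :: "real mat" and \<beta> :: "real vec" and \<sigma> :: real and N E :: "(nat \<Rightarrow> real) measure"
  assume n: "1 \<le> n" and np: "n \<le> p" and \<Omega>: "\<Omega> \<in> carrier_mat p p" "inverts_mat \<Sigma> \<Omega>"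
    and \<beta>: "\<beta> \<in> carrier_vec p" and \<sigma>: "0 < \<sigma>"
    and N: "centred_normal p \<Sigma> N" and E: "centred_normal n (\<sigma>\<^sup>2 \<cdot>\<^sub>m 1\<^sub>m n) E"
  let ?M = "design_noise_law n N E" and ?f = "squared_error n p \<Sigma> \<Omega> \<beta> \<sigma>"
  have p: "0 < p" using n np by simp
  obtain A s where A: "A \<in> carrier_mat p p" "A * transpose_mat A = \<Sigma>"
      "N = distr (gauss {..<p}) (coord_space p) (normal_map p A)"
      and s: "transpose_mat A *\<^sub>v \<beta> = vec p (\<lambda>i. if i = 0 then s else 0)"
    using centred_normal_aligned[OF N \<beta> p] by metis
  define h where "h w = (\<lambda>i\<in>{..<n}. - \<sigma> * w i)" for w :: "nat \<Rightarrow> real"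
  have E': "E = distr (gauss {..<n}) (coord_space n) h"
    using centred_normal_isotropic[OF E \<sigma>] by (simp add: h_def[abs_def])
  have h: "h \<in> gauss {..<n} \<rightarrow>\<^sub>M coord_space n"
    unfolding h_def[abs_def] using measurable_component_singleton[of _ "{..<n}" "\<lambda>_. std_normal_distribution"]
    by (intro measurable_restrict borel_measurable_times) auto
  have sets: "sets N = sets (coord_space p)" "sets E = sets (coord_space n)" by (simp_all add: A(3) E')
  have f: "?f \<in> borel_measurable ?M"
  proof (rule borel_measurable_squared_error[OF \<Omega>(1) \<beta>])
    show "(\<lambda>\<omega>. fst \<omega> i j) \<in> borel_measurable ?M" if "i < n" "j < p" for i j
    proof -
      have "(\<lambda>x. x j) \<in> borel_measurable N"
        using that measurable_component_singleton[of j "{..<p}" "\<lambda>_. borel"] by (simp cong: measurable_cong_sets add: sets)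
      moreover have "(\<lambda>\<omega>. fst \<omega> i) \<in> ?M \<rightarrow>\<^sub>M N"
        unfolding design_noise_law_def using that
        by (intro measurable_compose[OF measurable_fst measurable_component_singleton]) auto
      ultimately show ?thesis by (rule measurable_compose[rotated])
    qed
    show "(\<lambda>\<omega>. snd \<omega> i) \<in> borel_measurable ?M" if "i < n" for i
    proof -
      have "(\<lambda>x. x i) \<in> borel_measurable E"
        using that measurable_component_singleton[of i "{..<n}" "\<lambda>_. borel"] by (simp cong: measurable_cong_sets add: sets)
      then show ?thesis unfolding design_noise_law_def by (rule measurable_compose[OF measurable_snd])
    qed
  qed
  define \<tau> where "\<tau> = sqrt (s\<^sup>2 + \<sigma>\<^sup>2)"
  have "\<tau>\<^sup>2 = s\<^sup>2 + \<sigma>\<^sup>2" "\<tau>\<^sup>2 \<noteq> 0" using \<sigma> by (simp_all add: \<tau>_def)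
  then have cd: "(s / \<tau>)\<^sup>2 + (\<sigma> / \<tau>)\<^sup>2 = 1"
    unfolding power_divide add_divide_distrib[symmetric] by simp
  have nonneg: "0 \<le> ?f \<omega>" for \<omega> by (simp add: squared_error_def split_beta' Let_def)
  have "(\<integral>\<^sup>+\<omega>. ennreal (?f \<omega>) \<partial>?M)
      = (\<integral>\<^sup>+w. \<integral>\<^sup>+z. ennreal (?f (\<lambda>i\<in>{..<n}. normal_map p A (\<lambda>j\<in>{..<p}. z (i, j)), h w))
        \<partial>gauss ({..<n} \<times> {..<p}) \<partial>gauss {..<n})"
    using f by (intro nn_integral_design_noise_law[OF n p A(1,3) E' h]) simp
  also have "\<dots> = (\<integral>\<^sup>+w. \<integral>\<^sup>+z. ennreal ((proj_stat n {..<p} (\<lambda>i. s / \<tau> * z (i, 0) - \<sigma> / \<tau> * w i) (\<lambda>i j. z (i, j)) - (s / \<tau>)\<^sup>2)\<^sup>2)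
        \<partial>gauss ({..<n} \<times> {..<p}) \<partial>gauss {..<n})"
    unfolding h_def \<tau>_def by (subst squared_error_whitened[OF n A(1,2) \<Omega> \<beta> s p \<sigma>]) simp
  also have "\<dots> \<le> ennreal (15 * real p / (real n)\<^sup>2)"
    by (rule nn_integral_proj_stat[OF n np cd])
  finally have bound: "(\<integral>\<^sup>+\<omega>. ennreal (?f \<omega>) \<partial>?M) \<le> ennreal (15 * real p / (real n)\<^sup>2)" .
  \<comment> \<open>The Bochner integral of a non-integrable function is 0 by default, so the bound
    on the expectation has content only together with integrability. Both follow from the one bound
    on the nonnegative integral.\<close>
  show int: "integrable ?M ?f"
    using f nonneg bound by (intro integrableI_nonneg) (auto intro: le_less_trans)
  have "ennreal (\<integral>\<omega>. ?f \<omega> \<partial>?M) \<le> ennreal (15 * real p / (real n)\<^sup>2)"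
    using nn_integral_eq_integral[OF int] nonneg bound by simp
  then show "(\<integral>\<omega>. ?f \<omega> \<partial>?M) \<le> 15 * real p / (real n)\<^sup>2"
    by (subst (asm) ennreal_le_iff) auto
qed

end
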